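(* Let $B_1,\ldots,B_\mu:\mathbb{R}^n\to\mathbb{R}^n$ be smooth vector fields and $\psi:\mathbb{R}^n\to\mathbb{R}$ a nonnegative smooth function with nonempty zero set. Consider the system $\dot p=\sum_{k=1}^\mu u_k B_k(p)$ under the control law \[ u_k=\sqrt{\omega_k}\cos(\omega_k t+\varphi_k)\,h_1(\psi(p))+\sqrt{\omega_k}\sin(\omega_k t+\varphi_k)\,h_2(\psi(p)),\quad k=1,\ldots,\mu, \] where $\omega_1,\ldots,\omega_\mu$ are pairwise distinct positive reals, $\varphi_1,\ldots,\varphi_\mu\in\mathbb{R}$, and $h_1,h_2$ are as in the context. Assume there exists $p^*\in\mathbb{R}^n$ such that (i) $\psi(p^* )=0$ is a strict local minimum of $\psi$ and the second derivative of $\psi$ at $p^*$ is positive definite; (ii) there exists a neighborhood $W$ of $p^*$ such that for every $p\in W$ the vectors $B_1(p),\ldots,B_\mu(p)$ span $\mathbb{R}^n$. Then there exist constants $c,r>0$ such that for every $t_0\in\mathbb{R}$ and every $p_0$ in the connected component of $\{p\in\mathbb{R}^n\mid \psi(p)\leq r\}$ containing $p^*$, the maximal solution $\gamma$ of the closed-loop system with $\gamma(t_0)=p_0$ exists on $[t_0,\infty)$, $\gamma(t)\to p^*$ as $t\to\infty$, and \[ \psi(\gamma(t))\leq\frac{2\,\psi(p_0)}{1+c\,\psi(p_0)\,(t-t_0)}\quad\text{for every } t\geq t_0. \]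
   Context: The functions $h_1,h_2:\mathbb{R}\to\mathbb{R}$ satisfy, for $\nu=1,2$: (i) $h_\nu(y)=0$ for $y\leq 0$; (ii) $h_\nu$ is bounded and of class $C^2$ on $(0,\infty)$; (iii) $h_\nu(y)/y$ remains bounded as $y\downarrow 0$; (iv) $h_\nu'(y)$ remains bounded as $y\downarrow0$; (v) $h_\nu''(y)\,y$ remains bounded as $y\downarrow 0$; (vi) there exist $r',c'>0$ with $h_2'(y)h_1(y)-h_1'(y)h_2(y)\leq -c'y$ for all $y\in(0,r']$. *)

theory Defs
  imports "HOL-Analysis.Analysis"
begin

definition partial :: "'n::finite \<Rightarrow> (real^'n \<Rightarrow> real) \<Rightarrow> real^'n \<Rightarrow> real" where
  "partial i f x = frechet_derivative f (at x) (axis i 1)"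

fun Ck :: "nat \<Rightarrow> (real^'n::finite \<Rightarrow> real) \<Rightarrow> bool" where
  "Ck 0 f = continuous_on UNIV f"
| "Ck (Suc k) f = ((\<forall>x. f differentiable (at x)) \<and> (\<forall>i. Ck k (partial i f)))"

definition smooth_fun :: "(real^'n::finite \<Rightarrow> real) \<Rightarrow> bool" where
  "smooth_fun f \<longleftrightarrow> (\<forall>k. Ck k f)"

definition smooth_vf :: "(real^'n::finite \<Rightarrow> real^'n) \<Rightarrow> bool" where
  "smooth_vf B \<longleftrightarrow> (\<forall>j. smooth_fun (\<lambda>p. B p $ j))"

definition hessian_posdef :: "(real^'n::finite \<Rightarrow> real) \<Rightarrow> real^'n \<Rightarrow> bool" where
  "hessian_posdef f p \<longleftrightarrow>
     (\<forall>v::real^'n. v \<noteq> 0 \<longrightarrow> (\<Sum>i\<in>UNIV. \<Sum>j\<in>UNIV. v$i * v$j * partial i (partial j f) p) > 0)"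

definition admissible_h :: "(real \<Rightarrow> real) \<Rightarrow> bool" where
  "admissible_h h \<longleftrightarrow>
     (\<forall>y\<le>0. h y = 0) \<and>
     bounded (h ` {0<..}) \<and>
     (\<forall>y>0. h differentiable (at y) \<and> deriv h differentiable (at y)) \<and>
     continuous_on {0<..} (deriv (deriv h)) \<and>
     (\<exists>M \<delta>. \<delta> > 0 \<and> (\<forall>y. 0 < y \<and> y < \<delta> \<longrightarrow> \<bar>h y / y\<bar> \<le> M)) \<and>
     (\<exists>M \<delta>. \<delta> > 0 \<and> (\<forall>y. 0 < y \<and> y < \<delta> \<longrightarrow> \<bar>deriv h y\<bar> \<le> M)) \<and>
     (\<exists>M \<delta>. \<delta> > 0 \<and> (\<forall>y. 0 < y \<and> y < \<delta> \<longrightarrow> \<bar>deriv (deriv h) y * y\<bar> \<le> M))"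

definition closed_loop ::
  "nat \<Rightarrow> (nat \<Rightarrow> real^'n::finite \<Rightarrow> real^'n) \<Rightarrow> (real^'n \<Rightarrow> real) \<Rightarrow> (nat \<Rightarrow> real) \<Rightarrow> (nat \<Rightarrow> real)
    \<Rightarrow> (real \<Rightarrow> real) \<Rightarrow> (real \<Rightarrow> real) \<Rightarrow> real \<Rightarrow> real^'n \<Rightarrow> real^'n" where
  "closed_loop \<mu> B \<psi> \<omega> \<phi> h1 h2 t p =
     (\<Sum>k=1..\<mu>. (sqrt (\<omega> k) * cos (\<omega> k * t + \<phi> k) * h1 (\<psi> p)
               + sqrt (\<omega> k) * sin (\<omega> k * t + \<phi> k) * h2 (\<psi> p)) *\<^sub>R B k p)"

end

(* Along the closed loop, psi' is a sum of terms F_i of size psi^(3/2), each multiplied by an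
   oscillating coefficient. Since the frequencies are fixed and not large, the small parameter of the
   averaging argument is psi itself: near pstar, every derivative along the control fields gains
   a factor sqrt psi. Integrating by parts twice produces z = psi + O(psi^(3/2)) with
   z' <= - c psi^2 + O(psi^(5/2)). The psi^2 term is the mean of the products of the dithers; it collects
   the Lie brackets of h1(psi) B_k and h2(psi) B_k applied to psi, that is
   (h2 h1' - h1 h2')(psi) (B_k psi)^2 / 2, so condition (vi), the spanning assumption
   and the Hessian bound give its sign. Hence 1/z grows at least linearly, which keeps the
   solution in a small ball. *)

theory Submission
  imports Defs
begin

section \<open>Smooth functions and vector fields\<close>

text \<open>The gains are differentiable only for positive arguments and their second derivatives
  may blow up like 1/y at zero. Conditions (iii) to (v) are what makes \<open>h\<close> and
  \<open>deriv h\<close>, composed with \<open>\<psi>\<close>, symbols of orders 2 and 0 in the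
  weight \<open>sqrt \<psi>\<close>; together with the Lie derivatives of \<open>\<psi>\<close> they
  carry the whole order count. The calculus runs only where \<open>\<psi>\<close> is positive, and a
  two-sided exponential bound shows that a solution starting there stays there, while one starting
  at the zero stays at the zero. Since \<open>\<psi>\<close> need not decrease along a solution,
  sublevel sets need not be invariant. The factor 2 in the estimate is the price of passing from
  \<open>\<psi>\<close> to \<open>z\<close> and back, and \<open>r\<close> is chosen so that even
  doubling \<open>\<psi>\<close> does not reach the sphere bounding the ball. The estimate first
  holds as long as the solution is in the ball; a first-exit argument removes this proviso. It is
  derived for an arbitrary solution, whereas existence comes from gains that are Lipschitz up to
  zero.\<close>

lemma Ck_Suc_imp_Ck: "Ck (Suc k) f \<Longrightarrow> Ck k f"
proof (induction k arbitrary: f)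
  case 0
  then show ?case
    by (auto intro!: continuous_at_imp_continuous_on differentiable_imp_continuous_within)
next
  case (Suc k)
  then show ?case by auto
qed

lemma smooth_fun_differentiable: "smooth_fun f \<Longrightarrow> f differentiable (at x)"
  unfolding smooth_fun_def using Ck.simps(2)[of 0 f] by blast

lemma smooth_fun_continuous_on: "smooth_fun f \<Longrightarrow> continuous_on S f"
  unfolding smooth_fun_def using Ck.simps(1)[of f] continuous_on_subset by blast

lemma smooth_fun_partial: "smooth_fun f \<Longrightarrow> smooth_fun (partial i f)"
  unfolding smooth_fun_def using Ck.simps(2) by blast

lemma partial_add:
  assumes "\<And>x. f differentiable (at x)" "\<And>x. g differentiable (at x)"
  shows "partial i (\<lambda>x. f x + g x) = (\<lambda>x. partial i f x + partial i g x)"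
  unfolding partial_def
  by (rule ext) (simp add: frechet_derivative_at[OF has_derivative_add
        [OF frechet_derivative_works[THEN iffD1, OF assms(1)]
            frechet_derivative_works[THEN iffD1, OF assms(2)]], symmetric])

lemma partial_mult:
  assumes "\<And>x. f differentiable (at x)" "\<And>x. g differentiable (at x)"
  shows "partial i (\<lambda>x. f x * g x) = (\<lambda>x. f x * partial i g x + partial i f x * g x)"
  unfolding partial_def
  by (rule ext) (simp add: frechet_derivative_at[OF has_derivative_mult
        [OF frechet_derivative_works[THEN iffD1, OF assms(1)]
            frechet_derivative_works[THEN iffD1, OF assms(2)]], symmetric])

lemma Ck_add: "Ck k f \<Longrightarrow> Ck k g \<Longrightarrow> Ck k (\<lambda>x. f x + g x)"
  by (induction k arbitrary: f g) (auto intro: continuous_on_add simp: partial_add)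

lemma Ck_mult: "Ck k f \<Longrightarrow> Ck k g \<Longrightarrow> Ck k (\<lambda>x. f x * g x)"
proof (induction k arbitrary: f g)
  case 0
  then show ?case by (auto intro: continuous_on_mult)
next
  case (Suc k)
  then show ?case
    \<comment> \<open>The product rule leaves one factor undifferentiated, and the induction
      hypothesis wants that factor one order lower than it is given.\<close>
    using Ck_Suc_imp_Ck[OF Suc.prems(1)] Ck_Suc_imp_Ck[OF Suc.prems(2)]
    by (auto simp: partial_mult intro!: Ck_add)
qed

lemma Ck_const: "Ck k (\<lambda>_. c)"
proof (induction k arbitrary: c)
  case (Suc k)
  have "partial i (\<lambda>_::real^'a. c) = (\<lambda>_. 0)" for i
    by (auto simp: partial_def)
  with Suc show ?case by simp
qed simp

lemma smooth_fun_sum: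
  assumes "\<And>i. i \<in> I \<Longrightarrow> smooth_fun (f i)"
  shows "smooth_fun (\<lambda>x. \<Sum>i\<in>I. f i x)"
  using assms
  by (induction I rule: infinite_finite_induct) (auto simp: smooth_fun_def Ck_const Ck_add)

lemma smooth_fun_mult: "smooth_fun f \<Longrightarrow> smooth_fun g \<Longrightarrow> smooth_fun (\<lambda>x. f x * g x)"
  by (simp add: smooth_fun_def Ck_mult)

text \<open>The derivative of \<open>f\<close> along \<open>B\<close>, in coordinates so that
  smoothness follows from closure under sums and products. Estimates use the inner product form
  \<open>lie_eq_inner\<close>.\<close>

definition lie :: "(real^'n::finite \<Rightarrow> real^'n) \<Rightarrow> (real^'n \<Rightarrow> real) \<Rightarrow> real^'n \<Rightarrow> real" where
  "lie B f p = (\<Sum>i\<in>UNIV. B p $ i * partial i f p)"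

definition grad :: "(real^'n::finite \<Rightarrow> real) \<Rightarrow> real^'n \<Rightarrow> real^'n" where
  "grad f p = (\<chi> i. partial i f p)"

lemma lie_eq_inner: "lie B f p = grad f p \<bullet> B p"
  by (simp add: lie_def grad_def inner_vec_def mult.commute)

lemma smooth_fun_lie: "smooth_vf B \<Longrightarrow> smooth_fun f \<Longrightarrow> smooth_fun (lie B f)"
  unfolding lie_def[abs_def] smooth_vf_def
  by (intro smooth_fun_sum smooth_fun_mult smooth_fun_partial) auto

lemma frechet_derivative_eq_grad:
  fixes f :: "real^'n::finite \<Rightarrow> real"
  assumes "f differentiable (at x)"
  shows "frechet_derivative f (at x) v = grad f x \<bullet> v"
proof -
  interpret bounded_linear "frechet_derivative f (at x)"
    using assms by (intro has_derivative_bounded_linear) (simp add: frechet_derivative_works)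
  have "frechet_derivative f (at x) v = frechet_derivative f (at x) (\<Sum>i\<in>UNIV. v $ i *\<^sub>R axis i 1)"
    by (simp add: basis_expansion scalar_mult_eq_scaleR[symmetric])
  also have "\<dots> = grad f x \<bullet> v"
    by (simp add: sum scaleR grad_def inner_vec_def partial_def mult.commute)
  finally show ?thesis .
qed

lemma smooth_fun_has_derivative:
  assumes "smooth_fun f"
  shows "(f has_derivative (\<lambda>v. grad f x \<bullet> v)) (at x)"
proof -
  have "frechet_derivative f (at x) = (\<lambda>v. grad f x \<bullet> v)"
    using frechet_derivative_eq_grad smooth_fun_differentiable[OF assms] by blast
  then show ?thesis
    using smooth_fun_differentiable[OF assms, of x] by (simp add: frechet_derivative_works)
qed

lemma continuous_on_grad: "smooth_fun f \<Longrightarrow> continuous_on S (grad f)"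
  unfolding grad_def[abs_def]
  by (intro continuous_on_vec_lambda smooth_fun_continuous_on smooth_fun_partial)

lemma compact_norm_bound:
  fixes f :: "'a::topological_space \<Rightarrow> 'b::real_normed_vector"
  assumes "compact K" "continuous_on K f"
  obtains C where "C > 0" "\<And>x. x \<in> K \<Longrightarrow> norm (f x) \<le> C"
proof -
  have "bounded (f ` K)"
    using assms by (intro compact_imp_bounded compact_continuous_image)
  then show ?thesis
    using that by (auto simp: bounded_pos)
qed

text \<open>Convexity keeps segments inside \<open>K\<close>, so a bound of the gradient on the
  compact set serves as Lipschitz constant.\<close>

lemma smooth_fun_lipschitz:
  fixes f :: "real^'n::finite \<Rightarrow> real"
  assumes "smooth_fun f" "compact K" "convex K"
  obtains L where "L-lipschitz_on K f"
proof -
  obtain C where C: "C > 0" "\<And>x. x \<in> K \<Longrightarrow> norm (grad f x) \<le> C"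
    using compact_norm_bound[OF assms(2) continuous_on_grad[OF assms(1)]] by blast
  have "C-lipschitz_on K f"
  proof (rule bounded_derivative_imp_lipschitz)
    fix x assume "x \<in> K"
    show "(f has_derivative (\<lambda>v. grad f x \<bullet> v)) (at x within K)"
      using smooth_fun_has_derivative[OF assms(1)] by (rule has_derivative_at_withinI)
    have "\<bar>grad f x \<bullet> v\<bar> \<le> C * norm v" for v
      using Cauchy_Schwarz_ineq2[of "grad f x" v] C(2)[OF \<open>x \<in> K\<close>]
      by (meson mult_right_mono norm_ge_zero order_trans)
    then show "onorm (\<lambda>v. grad f x \<bullet> v) \<le> C"
      using C(1) by (intro onorm_bound) auto
  qed (use assms C in auto)
  then show ?thesis by (rule that)
qed

lemma smooth_vf_lipschitz:
  fixes B :: "real^'n::finite \<Rightarrow> real^'n"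
  assumes "smooth_vf B" "compact K" "convex K"
  obtains L where "L-lipschitz_on K B"
proof -
  have "\<exists>L. L-lipschitz_on K (\<lambda>p. B p $ j)" for j
    using assms smooth_fun_lipschitz[of "\<lambda>p. B p $ j" K] unfolding smooth_vf_def by metis
  then obtain L where L: "\<And>j. (L j)-lipschitz_on K (\<lambda>p. B p $ j)"
    by metis
  have "(\<Sum>j\<in>UNIV. L j)-lipschitz_on K B"
  proof (rule lipschitz_onI)
    fix x y assume xy: "x \<in> K" "y \<in> K"
    have "dist (B x) (B y) \<le> (\<Sum>j\<in>UNIV. \<bar>(B x - B y) $ j\<bar>)"
      unfolding dist_norm by (rule norm_le_l1_cart)
    also have "\<dots> \<le> (\<Sum>j\<in>UNIV. L j * dist x y)"
      using lipschitz_onD[OF L xy] by (intro sum_mono) (simp add: dist_real_def)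
    finally show "dist (B x) (B y) \<le> (\<Sum>j\<in>UNIV. L j) * dist x y"
      by (simp add: sum_distrib_right)
  qed (use lipschitz_on_nonneg[OF L] in \<open>auto intro: sum_nonneg\<close>)
  then show ?thesis by (rule that)
qed

lemma smooth_vf_continuous_on: "smooth_vf B \<Longrightarrow> continuous_on S B"
proof -
  assume "smooth_vf B"
  then have "continuous_on S (\<lambda>p. \<chi> j. B p $ j)"
    unfolding smooth_vf_def by (intro continuous_on_vec_lambda smooth_fun_continuous_on) auto
  then show ?thesis by simp
qed

section \<open>Nondegenerate minima\<close>

text \<open>The quadratic form inside \<open>hessian_posdef\<close>, made a function of the vector
  so that it can be minimised over the unit sphere and recognised as the second derivative along
  rays.\<close>

definition hess_form :: "(real^'n::finite \<Rightarrow> real) \<Rightarrow> real^'n \<Rightarrow> real^'n \<Rightarrow> real" where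
  "hess_form f p v = (\<Sum>i\<in>UNIV. \<Sum>j\<in>UNIV. v$i * v$j * partial i (partial j f) p)"

lemma smooth_vf_grad: "smooth_fun f \<Longrightarrow> smooth_vf (grad f)"
  by (simp add: smooth_vf_def grad_def smooth_fun_partial)

lemma DERIV_along_ray:
  assumes "smooth_fun f"
  shows "((\<lambda>\<tau>. f (p + \<tau> *\<^sub>R w)) has_real_derivative (grad f (p + \<tau> *\<^sub>R w) \<bullet> w)) (at \<tau>)"
proof -
  have "((\<lambda>\<tau>. f (p + \<tau> *\<^sub>R w)) has_derivative (\<lambda>h. grad f (p + \<tau> *\<^sub>R w) \<bullet> (h *\<^sub>R w))) (at \<tau>)"
    by (rule has_derivative_compose[OF _ smooth_fun_has_derivative[OF assms]])
       (auto intro!: derivative_eq_intros)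
  then show ?thesis
    by (simp add: has_field_derivative_def mult_commute_abs)
qed

lemma DERIV_grad_along_ray:
  assumes "smooth_fun f"
  shows "((\<lambda>\<tau>. grad f (p + \<tau> *\<^sub>R w) \<bullet> w) has_real_derivative hess_form f (p + \<tau> *\<^sub>R w) w) (at \<tau>)"
proof -
  have "((\<lambda>\<tau>. \<Sum>j\<in>UNIV. partial j f (p + \<tau> *\<^sub>R w) * w $ j) has_real_derivative
     (\<Sum>j\<in>UNIV. (grad (partial j f) (p + \<tau> *\<^sub>R w) \<bullet> w) * w $ j)) (at \<tau>)"
    by (intro DERIV_sum DERIV_cmult_right DERIV_along_ray smooth_fun_partial assms)
  also have "(\<Sum>j\<in>UNIV. (grad (partial j f) (p + \<tau> *\<^sub>R w) \<bullet> w) * w $ j) = hess_form f (p + \<tau> *\<^sub>R w) w"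
    unfolding hess_form_def
    by (subst sum.swap) (simp add: inner_vec_def grad_def sum_distrib_left sum_distrib_right mult_ac)
  finally show ?thesis
    by (simp add: inner_vec_def grad_def)
qed

lemma hess_form_scaleR: "hess_form f p (a *\<^sub>R v) = a\<^sup>2 * hess_form f p v"
  by (simp add: hess_form_def sum_distrib_left power2_eq_square mult_ac)

text \<open>The bound separates the base points from the direction: coercivity at the minimum
  thereby passes to nearby points uniformly in \<open>v\<close>.\<close>

lemma hess_form_diff_le:
  "\<bar>hess_form f p v - hess_form f q v\<bar> \<le>
     (\<Sum>i\<in>UNIV. \<Sum>j\<in>UNIV. \<bar>partial i (partial j f) p - partial i (partial j f) q\<bar>) * (norm v)\<^sup>2"
proof -
  have "\<bar>hess_form f p v - hess_form f q v\<bar> =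
      \<bar>\<Sum>i\<in>UNIV. \<Sum>j\<in>UNIV. v$i * v$j * (partial i (partial j f) p - partial i (partial j f) q)\<bar>"
    by (simp add: hess_form_def sum_subtractf right_diff_distrib)
  also have "\<dots> \<le> (\<Sum>i\<in>UNIV. \<Sum>j\<in>UNIV. \<bar>v$i * v$j * (partial i (partial j f) p - partial i (partial j f) q)\<bar>)"
    by (rule order_trans[OF sum_abs sum_mono[OF sum_abs]])
  also have "\<dots> \<le> (\<Sum>i\<in>UNIV. \<Sum>j\<in>UNIV. (norm v)\<^sup>2 * \<bar>partial i (partial j f) p - partial i (partial j f) q\<bar>)"
    unfolding abs_mult power2_eq_square
    by (intro sum_mono mult_right_mono mult_mono component_le_norm_cart) auto
  finally show ?thesis
    by (simp add: sum_distrib_left mult.commute)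
qed

text \<open>A positive continuous form has a positive minimum on the compact unit sphere, and
  homogeneity of degree two carries it to all vectors.\<close>

lemma hessian_posdef_imp_coercive:
  fixes f :: "real^'n::finite \<Rightarrow> real"
  assumes "hessian_posdef f p"
  obtains m where "m > 0" "\<And>v. m * (norm v)\<^sup>2 \<le> hess_form f p v"
proof -
  \<comment> \<open>Any coordinate vector will do: it only witnesses that the sphere is
    nonempty.\<close>
  have "axis undefined 1 \<in> sphere (0::real^'n) 1"
    by simp
  then have "sphere (0::real^'n) 1 \<noteq> {}"
    by blast
  moreover have "continuous_on (sphere 0 1) (hess_form f p)"
    unfolding hess_form_def[abs_def] by (intro continuous_intros)
  ultimately obtain v0 where v0: "v0 \<in> sphere 0 1" "\<And>v. v \<in> sphere 0 1 \<Longrightarrow> hess_form f p v0 \<le> hess_form f p v"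
    using continuous_attains_inf[OF compact_sphere] by blast
  show thesis
  proof
    have "v0 \<noteq> 0" using v0(1) by auto
    then show "hess_form f p v0 > 0"
      using assms by (simp add: hess_form_def hessian_posdef_def)
    show "hess_form f p v0 * (norm v)\<^sup>2 \<le> hess_form f p v" for v
    proof (cases "v = 0")
      case False
      then have "hess_form f p v0 \<le> hess_form f p ((1 / norm v) *\<^sub>R v)"
        by (intro v0) simp
      with False show ?thesis
        by (simp only: hess_form_scaleR) (simp add: field_simps)
    qed (simp add: hess_form_def)
  qed
qed

text \<open>Near the minimum the Hessian keeps half of its coercivity. Integrating along rays from
  \<open>p0\<close>, once for the gradient and twice for \<open>f\<close>, gives the lower bounds;
  the upper bounds come from the gradient being Lipschitz and zero at \<open>p0\<close>. Thus
  \<open>sqrt (f p)\<close>, the norm of the gradient and the distance to \<open>p0\<close> are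
  mutually comparable.\<close>

lemma nondegenerate_minimum_bounds:
  fixes f :: "real^'n::finite \<Rightarrow> real"
  assumes f: "smooth_fun f" and nonneg: "\<And>p. f p \<ge> 0" and zero: "f p0 = 0"
    and posdef: "hessian_posdef f p0"
  obtains R m C where "R > 0" "m > 0" "C > 0"
    "\<And>p. p \<in> cball p0 R \<Longrightarrow> m * (dist p p0)\<^sup>2 \<le> f p"
    "\<And>p. p \<in> cball p0 R \<Longrightarrow> f p \<le> C * (dist p p0)\<^sup>2"
    "\<And>p. p \<in> cball p0 R \<Longrightarrow> norm (grad f p) \<le> C * dist p p0"
    "\<And>p. p \<in> cball p0 R \<Longrightarrow> m * (dist p p0)\<^sup>2 \<le> grad f p \<bullet> (p - p0)"
proof -
  obtain m where m: "m > 0" "\<And>v. m * (norm v)\<^sup>2 \<le> hess_form f p0 v"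
    using hessian_posdef_imp_coercive[OF posdef] by blast
  \<comment> \<open>A zero of a nonnegative function is a global minimum, hence a critical
    point.\<close>
  have "(\<lambda>v. grad f p0 \<bullet> v) = (\<lambda>v. 0)"
    by (rule differential_zero_maxmin[OF _ open_UNIV smooth_fun_has_derivative[OF f]])
       (auto simp: zero nonneg)
  then have grad0: "grad f p0 = 0"
    by (metis inner_eq_zero_iff)
  \<comment> \<open>\<open>H\<close> measures how far the second derivatives have moved from those
    at \<open>p0\<close>. It is continuous and zero at \<open>p0\<close>, so it stays below
    \<open>m / 2\<close> on a small ball.\<close>
  define H where "H q = (\<Sum>i\<in>UNIV. \<Sum>j\<in>UNIV. \<bar>partial i (partial j f) q - partial i (partial j f) p0\<bar>)" for q
  have "continuous_on UNIV H"
    unfolding H_def[abs_def] by (intro continuous_intros smooth_fun_continuous_on smooth_fun_partial f)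
  then obtain d where d: "d > 0" "\<And>q. dist q p0 < d \<Longrightarrow> dist (H q) (H p0) < m / 2"
    using m(1) unfolding continuous_on_iff by (metis UNIV_I half_gt_zero)
  define R where "R = d / 2"
  have R: "R > 0" using d by (simp add: R_def)
  have H: "H q \<le> m / 2" if "dist q p0 \<le> R" for q
    using d(2)[of q] that d(1) by (simp add: H_def R_def dist_real_def)
  have hess: "m / 2 * (norm v)\<^sup>2 \<le> hess_form f q v" if "dist q p0 \<le> R" for q v
  proof -
    have "\<bar>hess_form f q v - hess_form f p0 v\<bar> \<le> H q * (norm v)\<^sup>2"
      unfolding H_def by (rule hess_form_diff_le)
    also have "\<dots> \<le> m / 2 * (norm v)\<^sup>2"
      by (intro mult_right_mono H that) auto
    finally show ?thesis
      using m(2)[of v] unfolding abs_le_iff by linarith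
  qed
  obtain L where L: "L-lipschitz_on (cball p0 R) (grad f)"
    using smooth_vf_lipschitz[OF smooth_vf_grad[OF f] compact_cball convex_cball] by blast
  have L0: "L \<ge> 0" using L by (rule lipschitz_on_nonneg)
  have gradL: "norm (grad f q) \<le> L * dist q p0" if "dist q p0 \<le> R" for q
    using lipschitz_onD[OF L, of q p0] that R grad0 by (simp add: dist_commute)
  show thesis
  \<comment> \<open>Integrating the slope \<open>m / 2 * \<tau>\<close> over the unit interval
    produces \<open>m / 4\<close>, used for both lower bounds. \<open>L + 1\<close> in place of
    \<open>L\<close> guarantees a positive constant.\<close>
  proof (rule that[of R "m / 4" "L + 1"])
    fix p assume p: "p \<in> cball p0 R"
    define w where "w = p - p0"
    have w: "norm w = dist p p0" "p = p0 + 1 *\<^sub>R w"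
      by (simp_all add: w_def dist_norm)
    have inR: "dist (p0 + \<tau> *\<^sub>R w) p0 \<le> R" if "0 \<le> \<tau>" "\<tau> \<le> 1" for \<tau>
      using that p w(1) mult_right_mono[of \<tau> 1 "norm w"]
      by (simp add: dist_norm) (metis dist_commute dist_norm order_trans)
    have mono1: "m / 2 * (norm w)\<^sup>2 * \<tau> \<le> grad f (p0 + \<tau> *\<^sub>R w) \<bullet> w" if "0 \<le> \<tau>" "\<tau> \<le> 1" for \<tau>
    proof -
      define k where "k \<tau> = grad f (p0 + \<tau> *\<^sub>R w) \<bullet> w - m / 2 * (norm w)\<^sup>2 * \<tau>" for \<tau>
      have "k 0 \<le> k \<tau>"
      proof (rule DERIV_nonneg_imp_nondecreasing[OF that(1)])
        fix x assume x: "0 \<le> x" "x \<le> \<tau>"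
        have "(k has_real_derivative hess_form f (p0 + x *\<^sub>R w) w - m / 2 * (norm w)\<^sup>2) (at x)"
          unfolding k_def[abs_def]
          by (rule DERIV_diff[OF DERIV_grad_along_ray[OF f]]) (auto intro!: derivative_eq_intros)
        moreover have "0 \<le> hess_form f (p0 + x *\<^sub>R w) w - m / 2 * (norm w)\<^sup>2"
          using hess[OF inR, of x w] x that by simp
        ultimately show "\<exists>y. (k has_real_derivative y) (at x) \<and> 0 \<le> y" by blast
      qed
      then show ?thesis by (simp add: grad0 k_def)
    qed
    define k where "k \<tau> = f (p0 + \<tau> *\<^sub>R w) - m / 4 * (norm w)\<^sup>2 * \<tau>\<^sup>2" for \<tau>
    have "k 0 \<le> k 1"
    proof (rule DERIV_nonneg_imp_nondecreasing[of 0 1 k])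
      fix x :: real assume x: "0 \<le> x" "x \<le> 1"
      have "(k has_real_derivative grad f (p0 + x *\<^sub>R w) \<bullet> w - m / 2 * (norm w)\<^sup>2 * x) (at x)"
        unfolding k_def[abs_def]
        by (rule DERIV_diff[OF DERIV_along_ray[OF f]]) (auto intro!: derivative_eq_intros)
      moreover have "0 \<le> grad f (p0 + x *\<^sub>R w) \<bullet> w - m / 2 * (norm w)\<^sup>2 * x"
        using mono1[OF x] by simp
      ultimately show "\<exists>y. (k has_real_derivative y) (at x) \<and> 0 \<le> y" by blast
    qed simp
    then show "m / 4 * (dist p p0)\<^sup>2 \<le> f p"
      by (simp add: zero w k_def)
    show "m / 4 * (dist p p0)\<^sup>2 \<le> grad f p \<bullet> (p - p0)"
    proof -
      have "m / 4 * (dist p p0)\<^sup>2 \<le> m / 2 * (dist p p0)\<^sup>2"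
        using m(1) by (intro mult_right_mono) auto
      with mono1[of 1] show ?thesis by (simp add: w_def dist_norm)
    qed
    show gC: "norm (grad f p) \<le> (L + 1) * dist p p0"
    proof -
      have "norm (grad f p) \<le> L * dist p p0"
        using gradL[of p] p by (simp add: dist_commute)
      also have "\<dots> \<le> (L + 1) * dist p p0" by (intro mult_right_mono) auto
      finally show ?thesis .
    qed
    obtain \<xi> where \<xi>: "0 < \<xi>" "\<xi> < 1" "f (p0 + 1 *\<^sub>R w) - f (p0 + 0 *\<^sub>R w) = (1 - 0) * (grad f (p0 + \<xi> *\<^sub>R w) \<bullet> w)"
      using MVT2[of 0 1 "\<lambda>\<tau>. f (p0 + \<tau> *\<^sub>R w)" "\<lambda>\<tau>. grad f (p0 + \<tau> *\<^sub>R w) \<bullet> w"] DERIV_along_ray[OF f]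
      by auto
    then have "f p = grad f (p0 + \<xi> *\<^sub>R w) \<bullet> w"
      by (simp add: zero w(2)[symmetric] del: scaleR_one)
    also have "\<dots> \<le> norm (grad f (p0 + \<xi> *\<^sub>R w)) * norm w"
      by (rule norm_cauchy_schwarz)
    also have "\<dots> \<le> (L * (\<xi> * norm w)) * norm w"
      using gradL[OF inR, of \<xi>] \<xi> by (intro mult_right_mono) (auto simp: dist_norm)
    also have "\<dots> \<le> (L * (1 * norm w)) * norm w"
      using \<xi> L0 by (intro mult_right_mono mult_left_mono) auto
    also have "\<dots> \<le> (L + 1) * (dist p p0)\<^sup>2"
      by (simp add: w power2_eq_square algebra_simps)
    finally show "f p \<le> (L + 1) * (dist p p0)\<^sup>2" .
  qed (use R m L0 in auto)
qed

section \<open>Symbol classes and oscillating primitives\<close>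

text \<open>Symbols of order \<open>n\<close> in a weight \<open>\<sigma>\<close>, which will be \<open>sqrt \<circ> \<psi>\<close>: each derivative costs one power of \<open>\<sigma>\<close>. The factor
  \<open>\<sigma>\<close> is kept on the left so that order 0 is allowed without negative powers.\<close>

definition symb :: "('a::real_normed_vector \<Rightarrow> real) \<Rightarrow> 'a set \<Rightarrow> nat \<Rightarrow> ('a \<Rightarrow> real) \<Rightarrow> bool" where
  "symb \<sigma> D n f \<longleftrightarrow> (\<exists>C\<ge>0. \<forall>p\<in>D. \<bar>f p\<bar> \<le> C * \<sigma> p ^ n \<and>
     (\<exists>f'. (f has_derivative f') (at p) \<and> (\<forall>v. \<sigma> p * \<bar>f' v\<bar> \<le> C * \<sigma> p ^ n * norm v)))"

lemma symbI:
  assumes "C \<ge> 0" "\<And>p. p \<in> D \<Longrightarrow> \<bar>f p\<bar> \<le> C * \<sigma> p ^ n"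
    "\<And>p. p \<in> D \<Longrightarrow> (f has_derivative f' p) (at p)"
    "\<And>p v. p \<in> D \<Longrightarrow> \<sigma> p * \<bar>f' p v\<bar> \<le> C * \<sigma> p ^ n * norm v"
  shows "symb \<sigma> D n f"
  unfolding symb_def using assms by blast

lemma symbE:
  assumes "symb \<sigma> D n f"
  obtains C f' where "C \<ge> 0" "\<And>p. p \<in> D \<Longrightarrow> \<bar>f p\<bar> \<le> C * \<sigma> p ^ n"
    "\<And>p. p \<in> D \<Longrightarrow> (f has_derivative f' p) (at p)"
    "\<And>p v. p \<in> D \<Longrightarrow> \<sigma> p * \<bar>f' p v\<bar> \<le> C * \<sigma> p ^ n * norm v"
proof -
  from assms obtain C where C: "C \<ge> 0" "\<forall>p\<in>D. \<exists>f'. \<bar>f p\<bar> \<le> C * \<sigma> p ^ n \<and>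
     (f has_derivative f') (at p) \<and> (\<forall>v. \<sigma> p * \<bar>f' v\<bar> \<le> C * \<sigma> p ^ n * norm v)"
    unfolding symb_def by blast
  from bchoice[OF C(2)] C(1) show thesis
    by (blast intro: that)
qed

lemma symb_add:
  assumes "symb \<sigma> D n f" "symb \<sigma> D n g" and \<sigma>: "\<And>p. p \<in> D \<Longrightarrow> \<sigma> p \<ge> 0"
  shows "symb \<sigma> D n (\<lambda>p. f p + g p)"
proof -
  obtain C f' where f: "C \<ge> 0" "\<And>p. p \<in> D \<Longrightarrow> \<bar>f p\<bar> \<le> C * \<sigma> p ^ n"
    "\<And>p. p \<in> D \<Longrightarrow> (f has_derivative f' p) (at p)"
    "\<And>p v. p \<in> D \<Longrightarrow> \<sigma> p * \<bar>f' p v\<bar> \<le> C * \<sigma> p ^ n * norm v"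
    using symbE[OF assms(1)] by blast
  obtain E g' where g: "E \<ge> 0" "\<And>p. p \<in> D \<Longrightarrow> \<bar>g p\<bar> \<le> E * \<sigma> p ^ n"
    "\<And>p. p \<in> D \<Longrightarrow> (g has_derivative g' p) (at p)"
    "\<And>p v. p \<in> D \<Longrightarrow> \<sigma> p * \<bar>g' p v\<bar> \<le> E * \<sigma> p ^ n * norm v"
    using symbE[OF assms(2)] by blast
  show ?thesis
  proof (rule symbI[where C = "C + E" and f' = "\<lambda>p v. f' p v + g' p v"])
    fix p v assume p: "p \<in> D"
    show "\<bar>f p + g p\<bar> \<le> (C + E) * \<sigma> p ^ n"
      using f(2)[OF p] g(2)[OF p] by (simp add: distrib_right)
    have "\<sigma> p * \<bar>f' p v + g' p v\<bar> \<le> \<sigma> p * \<bar>f' p v\<bar> + \<sigma> p * \<bar>g' p v\<bar>"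
      using mult_left_mono[OF abs_triangle_ineq \<sigma>[OF p]] by (simp add: distrib_left)
    then show "\<sigma> p * \<bar>f' p v + g' p v\<bar> \<le> (C + E) * \<sigma> p ^ n * norm v"
      using f(4)[OF p, of v] g(4)[OF p, of v] by (simp add: distrib_right)
    show "((\<lambda>p. f p + g p) has_derivative (\<lambda>v. f' p v + g' p v)) (at p)"
      using f(3)[OF p] g(3)[OF p] by (rule has_derivative_add)
  qed (use f g in auto)
qed

text \<open>Each Leibniz term loses an order in only one of the two factors; the constant
  \<open>2 * C * E\<close> counts the two terms.\<close>

lemma symb_mult:
  assumes "symb \<sigma> D n f" "symb \<sigma> D m g" and \<sigma>: "\<And>p. p \<in> D \<Longrightarrow> \<sigma> p \<ge> 0"
  shows "symb \<sigma> D (n + m) (\<lambda>p. f p * g p)"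
proof -
  obtain C f' where f: "C \<ge> 0" "\<And>p. p \<in> D \<Longrightarrow> \<bar>f p\<bar> \<le> C * \<sigma> p ^ n"
    "\<And>p. p \<in> D \<Longrightarrow> (f has_derivative f' p) (at p)"
    "\<And>p v. p \<in> D \<Longrightarrow> \<sigma> p * \<bar>f' p v\<bar> \<le> C * \<sigma> p ^ n * norm v"
    using symbE[OF assms(1)] by blast
  obtain E g' where g: "E \<ge> 0" "\<And>p. p \<in> D \<Longrightarrow> \<bar>g p\<bar> \<le> E * \<sigma> p ^ m"
    "\<And>p. p \<in> D \<Longrightarrow> (g has_derivative g' p) (at p)"
    "\<And>p v. p \<in> D \<Longrightarrow> \<sigma> p * \<bar>g' p v\<bar> \<le> E * \<sigma> p ^ m * norm v"
    using symbE[OF assms(2)] by blast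
  show ?thesis
  proof (rule symbI[where C = "2 * C * E" and f' = "\<lambda>p v. f p * g' p v + f' p v * g p"])
    fix p v assume p: "p \<in> D"
    have "\<bar>f p\<bar> * \<bar>g p\<bar> \<le> (C * \<sigma> p ^ n) * (E * \<sigma> p ^ m)"
      using f(1) \<sigma>[OF p] by (intro mult_mono f g p) auto
    moreover have "0 \<le> (C * \<sigma> p ^ n) * (E * \<sigma> p ^ m)"
      using f(1) g(1) \<sigma>[OF p] by simp
    ultimately show "\<bar>f p * g p\<bar> \<le> 2 * C * E * \<sigma> p ^ (n + m)"
      by (simp add: abs_mult power_add mult_ac)
    have "\<sigma> p * \<bar>f p * g' p v + f' p v * g p\<bar> \<le> \<bar>f p\<bar> * (\<sigma> p * \<bar>g' p v\<bar>) + (\<sigma> p * \<bar>f' p v\<bar>) * \<bar>g p\<bar>"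
      using mult_left_mono[OF abs_triangle_ineq \<sigma>[OF p], of "f p * g' p v" "f' p v * g p"]
      by (simp add: abs_mult algebra_simps)
    also have "\<dots> \<le> (C * \<sigma> p ^ n) * (E * \<sigma> p ^ m * norm v) + (C * \<sigma> p ^ n * norm v) * (E * \<sigma> p ^ m)"
      using f(1) g(1) \<sigma>[OF p] by (intro add_mono mult_mono f g p) auto
    finally show "\<sigma> p * \<bar>f p * g' p v + f' p v * g p\<bar> \<le> 2 * C * E * \<sigma> p ^ (n + m) * norm v"
      by (simp add: power_add algebra_simps)
    show "((\<lambda>p. f p * g p) has_derivative (\<lambda>v. f p * g' p v + f' p v * g p)) (at p)"
      using f(3)[OF p] g(3)[OF p] by (rule has_derivative_mult)
  qed (use f g in auto)
qed

lemma symb_mult':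
  assumes "symb \<sigma> D n f" "symb \<sigma> D m g" "k = n + m" "\<And>p. p \<in> D \<Longrightarrow> \<sigma> p \<ge> 0"
  shows "symb \<sigma> D k (\<lambda>p. f p * g p)"
  using symb_mult assms by blast

text \<open>Merges the constants of a finite family into their sum, so that estimates of double sums
  need no constant depending on the index.\<close>

lemma symb_uniform:
  assumes "finite I" "\<forall>i\<in>I. symb \<sigma> D n (f i)" and \<sigma>: "\<forall>p\<in>D. \<sigma> p \<ge> 0"
  obtains C f' where "C \<ge> 0" "\<And>i p. i \<in> I \<Longrightarrow> p \<in> D \<Longrightarrow> \<bar>f i p\<bar> \<le> C * \<sigma> p ^ n"
    "\<And>i p. i \<in> I \<Longrightarrow> p \<in> D \<Longrightarrow> (f i has_derivative f' i p) (at p)"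
    "\<And>i p v. i \<in> I \<Longrightarrow> p \<in> D \<Longrightarrow> \<sigma> p * \<bar>f' i p v\<bar> \<le> C * \<sigma> p ^ n * norm v"
proof -
  \<comment> \<open>Constant and derivative are paired so that one application of choice selects
    both.\<close>
  have "\<forall>i\<in>I. \<exists>Cf. fst Cf \<ge> 0 \<and> (\<forall>p\<in>D. \<bar>f i p\<bar> \<le> fst Cf * \<sigma> p ^ n \<and>
     (f i has_derivative snd Cf p) (at p) \<and> (\<forall>v. \<sigma> p * \<bar>snd Cf p v\<bar> \<le> fst Cf * \<sigma> p ^ n * norm v))"
  proof
    fix i assume "i \<in> I"
    then obtain C f' where "C \<ge> 0" "\<And>p. p \<in> D \<Longrightarrow> \<bar>f i p\<bar> \<le> C * \<sigma> p ^ n"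
      "\<And>p. p \<in> D \<Longrightarrow> (f i has_derivative f' p) (at p)"
      "\<And>p v. p \<in> D \<Longrightarrow> \<sigma> p * \<bar>f' p v\<bar> \<le> C * \<sigma> p ^ n * norm v"
      using symbE[OF assms(2)[rule_format]] by blast
    then show "\<exists>Cf. fst Cf \<ge> 0 \<and> (\<forall>p\<in>D. \<bar>f i p\<bar> \<le> fst Cf * \<sigma> p ^ n \<and>
     (f i has_derivative snd Cf p) (at p) \<and> (\<forall>v. \<sigma> p * \<bar>snd Cf p v\<bar> \<le> fst Cf * \<sigma> p ^ n * norm v))"
      by (intro exI[of _ "(C, f')"]) simp
  qed
  from bchoice[OF this] obtain Cf where Cf: "\<forall>i\<in>I. fst (Cf i) \<ge> 0 \<and> (\<forall>p\<in>D. \<bar>f i p\<bar> \<le> fst (Cf i) * \<sigma> p ^ n \<and>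
     (f i has_derivative snd (Cf i) p) (at p) \<and> (\<forall>v. \<sigma> p * \<bar>snd (Cf i) p v\<bar> \<le> fst (Cf i) * \<sigma> p ^ n * norm v))"
    by blast
  define C where "C i = fst (Cf i)" for i
  define f' where "f' i = snd (Cf i)" for i
  have *: "\<And>i. i \<in> I \<Longrightarrow> C i \<ge> 0" "\<And>i p. i \<in> I \<Longrightarrow> p \<in> D \<Longrightarrow> \<bar>f i p\<bar> \<le> C i * \<sigma> p ^ n"
    "\<And>i p. i \<in> I \<Longrightarrow> p \<in> D \<Longrightarrow> (f i has_derivative f' i p) (at p)"
    "\<And>i p v. i \<in> I \<Longrightarrow> p \<in> D \<Longrightarrow> \<sigma> p * \<bar>f' i p v\<bar> \<le> C i * \<sigma> p ^ n * norm v"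
    using Cf by (simp_all add: C_def f'_def)
  have le: "C i \<le> sum C I" if "i \<in> I" for i
    using *(1) that assms(1) by (intro member_le_sum) auto
  show thesis
  proof (rule that)
    show "sum C I \<ge> 0" using * by (auto intro: sum_nonneg)
    fix i p v assume ip: "i \<in> I" "p \<in> D"
    have \<sigma>': "C i * \<sigma> p ^ n \<le> sum C I * \<sigma> p ^ n"
      using le[OF ip(1)] bspec[OF \<sigma> ip(2)] by (intro mult_right_mono) auto
    then show "\<bar>f i p\<bar> \<le> sum C I * \<sigma> p ^ n"
      using *(2)[OF ip] by linarith
    show "(f i has_derivative f' i p) (at p)" by (rule *(3)[OF ip])
    show "\<sigma> p * \<bar>f' i p v\<bar> \<le> sum C I * \<sigma> p ^ n * norm v"
      using *(4)[OF ip, of v] mult_right_mono[OF \<sigma>' norm_ge_zero[of v]] by linarith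
  qed
qed

section \<open>Bounded primitives of products of trigonometric functions\<close>

lemma DERIV_sin_primitive:
  fixes d :: real
  assumes "d \<noteq> 0"
  shows "((\<lambda>t. - (k / d) * cos (d * t + \<theta>)) has_real_derivative k * sin (d * t + \<theta>)) (at t)"
proof -
  have "((\<lambda>t. cos (d * t + \<theta>)) has_real_derivative - sin (d * t + \<theta>) * d) (at t)"
    by (auto intro!: derivative_eq_intros)
  from DERIV_cmult[OF this, of "- (k / d)"] assms show ?thesis by simp
qed

text \<open>The product-to-sum formula leaves the frequencies \<open>w + u\<close> and
  \<open>w - u\<close>. The first is positive; the second vanishes exactly when
  \<open>w = u\<close>, and then its term is a constant, the mean, which has to be subtracted for
  the primitive to be bounded.\<close>

lemma bounded_primitive_product:
  fixes w u \<alpha> \<beta> :: real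
  assumes "w > 0" "u > 0"
  obtains W C where "\<And>t. \<bar>W t\<bar> \<le> C"
    "\<And>t. (W has_real_derivative (sin (w * t + \<alpha>) / sqrt w) * (sqrt u * cos (u * t + \<beta>))
       - (if w = u then sin (\<alpha> - \<beta>) / 2 else 0)) (at t)"
proof -
  \<comment> \<open>Amplitude of both terms after the product-to-sum formula. It equals 1/2 when the
    frequencies agree, which is the 1/2 in the subtracted mean.\<close>
  define k where "k = sqrt u / (2 * sqrt w)"
  define W1 where "W1 t = - (k / (w + u)) * cos ((w + u) * t + (\<alpha> + \<beta>))" for t
  define W2 where "W2 t = - (k / (w - u)) * cos ((w - u) * t + (\<alpha> - \<beta>))" for t
  have bound: "\<bar>- x * cos y\<bar> \<le> \<bar>x\<bar>" for x y :: real
    using mult_left_mono[OF abs_cos_le_one, of "\<bar>x\<bar>" y] by (simp add: abs_mult)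
  have W1: "(W1 has_real_derivative k * sin ((w + u) * t + (\<alpha> + \<beta>))) (at t)" for t
    unfolding W1_def[abs_def] using assms by (intro DERIV_sin_primitive) simp
  have W2: "(W2 has_real_derivative k * sin ((w - u) * t + (\<alpha> - \<beta>))) (at t)" if "w \<noteq> u" for t
    unfolding W2_def[abs_def] using that by (intro DERIV_sin_primitive) simp
  have prod: "(sin (w * t + \<alpha>) / sqrt w) * (sqrt u * cos (u * t + \<beta>))
      = k * sin ((w + u) * t + (\<alpha> + \<beta>)) + k * sin ((w - u) * t + (\<alpha> - \<beta>))" for t
  proof -
    have "(w * t + \<alpha>) + (u * t + \<beta>) = (w + u) * t + (\<alpha> + \<beta>)"
      "(w * t + \<alpha>) - (u * t + \<beta>) = (w - u) * t + (\<alpha> - \<beta>)"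
      by (simp_all add: algebra_simps)
    note sum_diff = this
    have sc: "sin (w * t + \<alpha>) * cos (u * t + \<beta>)
        = (sin ((w + u) * t + (\<alpha> + \<beta>)) + sin ((w - u) * t + (\<alpha> - \<beta>))) / 2"
      by (simp only: sin_times_cos sum_diff)
    have "(sin (w * t + \<alpha>) / sqrt w) * (sqrt u * cos (u * t + \<beta>))
        = 2 * k * (sin (w * t + \<alpha>) * cos (u * t + \<beta>))"
      by (simp add: k_def)
    also have "\<dots> = k * (sin ((w + u) * t + (\<alpha> + \<beta>)) + sin ((w - u) * t + (\<alpha> - \<beta>)))"
      unfolding sc by simp
    finally show ?thesis by (simp only: distrib_left)
  qed
  show thesis
  proof (cases "w = u")
    case True
    then have k: "k = 1 / 2" using assms by (simp add: k_def)
    have "\<bar>W1 t\<bar> \<le> \<bar>k / (w + u)\<bar>" for t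
      unfolding W1_def by (rule bound)
    moreover have "k * sin ((w + u) * t + (\<alpha> + \<beta>)) + k * sin ((w - u) * t + (\<alpha> - \<beta>))
        - (if w = u then sin (\<alpha> - \<beta>) / 2 else 0) = k * sin ((w + u) * t + (\<alpha> + \<beta>))" for t
      unfolding k using True by simp
    ultimately show thesis
      using W1 by (intro that[of W1 "\<bar>k / (w + u)\<bar>"]) (simp_all only: prod)
  next
    case False
    have "\<bar>W1 t + W2 t\<bar> \<le> \<bar>k / (w + u)\<bar> + \<bar>k / (w - u)\<bar>" for t
      unfolding W1_def W2_def by (intro order_trans[OF abs_triangle_ineq] add_mono bound)
    then show thesis
      using DERIV_add[OF W1 W2[OF False]] False
      by (intro that[of "\<lambda>t. W1 t + W2 t" "\<bar>k / (w + u)\<bar> + \<bar>k / (w - u)\<bar>"]) (simp_all only: prod if_False diff_zero)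
  qed
qed

lemma DERIV_along_curve:
  assumes "(f has_derivative f') (at (\<gamma> t))" "(\<gamma> has_vector_derivative v) (at t within S)"
  shows "((\<lambda>t. f (\<gamma> t)) has_real_derivative f' v) (at t within S)"
proof -
  interpret bounded_linear f' using assms(1) by (rule has_derivative_bounded_linear)
  have "((\<lambda>t. f (\<gamma> t)) has_derivative (\<lambda>h. f' (h *\<^sub>R v))) (at t within S)"
    by (rule has_derivative_compose[where g = f and f = \<gamma>])
       (use assms in \<open>simp_all add: has_vector_derivative_def\<close>)
  then show ?thesis
    by (simp add: has_field_derivative_def scaleR mult_commute_abs)
qed

text \<open>\<open>z\<close> corrects \<open>\<psi>\<close> by the boundary terms of two integrations by parts:
  \<open>z = \<psi> - \<Sum> V i * F i + \<Sum> W i j * G i j\<close>.\<close>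

lemma second_order_averaging:
  fixes X :: "'i \<Rightarrow> 'a::real_normed_vector \<Rightarrow> 'a" and \<psi> :: "'a \<Rightarrow> real"
  assumes I: "finite I"
    and \<sigma>: "\<And>p. p \<in> D \<Longrightarrow> 0 < \<sigma> p \<and> \<sigma> p \<le> 1"
    and X: "\<And>i p. i \<in> I \<Longrightarrow> p \<in> D \<Longrightarrow> norm (X i p) \<le> A * (\<sigma> p)\<^sup>2"
    and v: "\<And>i t. i \<in> I \<Longrightarrow> \<bar>v i t\<bar> \<le> A"
    and V: "\<And>i t. i \<in> I \<Longrightarrow> \<bar>V i t\<bar> \<le> A" "\<And>i t. i \<in> I \<Longrightarrow> (V i has_real_derivative v i t) (at t)"
    and W: "\<And>i j t. i \<in> I \<Longrightarrow> j \<in> I \<Longrightarrow> \<bar>W i j t\<bar> \<le> A"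
      "\<And>i j t. i \<in> I \<Longrightarrow> j \<in> I \<Longrightarrow> (W i j has_real_derivative V i t * v j t - m i j) (at t)"
    and \<psi>: "\<And>p. p \<in> D \<Longrightarrow> (\<psi> has_derivative \<psi>' p) (at p)"
    and F: "\<And>i p. p \<in> D \<Longrightarrow> i \<in> I \<Longrightarrow> \<psi>' p (X i p) = F i p"
    and F': "\<And>i p. p \<in> D \<Longrightarrow> i \<in> I \<Longrightarrow> (F i has_derivative F' i p) (at p)"
    and symF: "\<And>i. i \<in> I \<Longrightarrow> symb \<sigma> D 3 (F i)"
    and G: "\<And>i j p. p \<in> D \<Longrightarrow> i \<in> I \<Longrightarrow> j \<in> I \<Longrightarrow> F' i p (X j p) = G i j p"
    and symG: "\<And>i j. i \<in> I \<Longrightarrow> j \<in> I \<Longrightarrow> symb \<sigma> D 4 (G i j)"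
  shows "\<exists>K\<ge>0. \<forall>\<gamma> S. (\<forall>t\<in>S. \<gamma> t \<in> D \<and>
       (\<gamma> has_vector_derivative (\<Sum>i\<in>I. v i t *\<^sub>R X i (\<gamma> t))) (at t within S)) \<longrightarrow>
     (\<exists>z z'. \<forall>t\<in>S. (z has_real_derivative z' t) (at t within S) \<and>
       \<bar>z t - \<psi> (\<gamma> t)\<bar> \<le> K * \<sigma> (\<gamma> t) ^ 3 \<and>
       \<bar>z' t + (\<Sum>i\<in>I. \<Sum>j\<in>I. m i j * G i j (\<gamma> t))\<bar> \<le> K * \<sigma> (\<gamma> t) ^ 5)"
proof -
  have \<sigma>0: "\<forall>p\<in>D. \<sigma> p \<ge> 0" using \<sigma> less_imp_le by blast
  define N where "N = real (card I)"
  have N: "N \<ge> 0" by (simp add: N_def)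
  \<comment> \<open>For empty \<open>I\<close> the hypotheses do not force \<open>A\<close> to be
    nonnegative, hence the absolute value.\<close>
  define B where "B = \<bar>A\<bar>"
  have B: "B \<ge> 0" "A \<le> B" by (simp_all add: B_def)
  have sF: "\<forall>i\<in>I. symb \<sigma> D 3 (F i)"
    using symF by blast
  obtain CF F'' where CF: "CF \<ge> 0" "\<And>i p. i \<in> I \<Longrightarrow> p \<in> D \<Longrightarrow> \<bar>F i p\<bar> \<le> CF * \<sigma> p ^ 3"
    "\<And>i p. i \<in> I \<Longrightarrow> p \<in> D \<Longrightarrow> (F i has_derivative F'' i p) (at p)"
    "\<And>i p v. i \<in> I \<Longrightarrow> p \<in> D \<Longrightarrow> \<sigma> p * \<bar>F'' i p v\<bar> \<le> CF * \<sigma> p ^ 3 * norm v"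
    by (fact symb_uniform[OF I sF \<sigma>0])
  have sG: "\<forall>ij\<in>I \<times> I. symb \<sigma> D 4 (case ij of (i, j) \<Rightarrow> G i j)"
    using symG by auto
  obtain CG G'' where CG: "CG \<ge> 0"
    "\<And>ij p. ij \<in> I \<times> I \<Longrightarrow> p \<in> D \<Longrightarrow> \<bar>(case ij of (i, j) \<Rightarrow> G i j) p\<bar> \<le> CG * \<sigma> p ^ 4"
    "\<And>ij p. ij \<in> I \<times> I \<Longrightarrow> p \<in> D \<Longrightarrow> ((case ij of (i, j) \<Rightarrow> G i j) has_derivative G'' ij p) (at p)"
    "\<And>ij p v. ij \<in> I \<times> I \<Longrightarrow> p \<in> D \<Longrightarrow> \<sigma> p * \<bar>G'' ij p v\<bar> \<le> CG * \<sigma> p ^ 4 * norm v"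
    by (fact symb_uniform[OF finite_cartesian_product[OF I I] sG \<sigma>0])
  define G' where "G' i j = G'' (i, j)" for i j
  have G1: "\<bar>G i j p\<bar> \<le> CG * \<sigma> p ^ 4" if "i \<in> I" "j \<in> I" "p \<in> D" for i j p
    using CG(2)[of "(i, j)" p] that by auto
  have G2: "(G i j has_derivative G' i j p) (at p)" if "i \<in> I" "j \<in> I" "p \<in> D" for i j p
    using CG(3)[of "(i, j)" p] that by (auto simp: G'_def)
  \<comment> \<open>Since \<open>\<sigma>\<close> is strictly positive on \<open>D\<close>, it can
    be cancelled, turning the symbol estimate of order 4 into a genuine derivative bound of order
    3.\<close>
  have G3: "\<bar>G' i j p w\<bar> \<le> CG * \<sigma> p ^ 3 * norm w" if "i \<in> I" "j \<in> I" "p \<in> D" for i j p w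
  proof -
    have "\<sigma> p * \<bar>G' i j p w\<bar> \<le> \<sigma> p * (CG * \<sigma> p ^ 3 * norm w)"
      using CG(4)[of "(i, j)" p w] that by (simp add: G'_def power4_eq_xxxx power3_eq_cube mult_ac)
    then show ?thesis using \<sigma>[OF that(3)] by simp
  qed
  \<comment> \<open>The first two summands bound the correctors in \<open>z - \<psi>\<close>, the
    third the derivatives of the \<open>G i j\<close> that survive in \<open>z'\<close>.\<close>
  define K where "K = N * (B * CF) + N * (N * (B * CG)) + N * (N * (B * (CG * (N * (B * B)))))"
  show ?thesis
  proof (intro exI[of _ K] conjI allI impI)
    show "K \<ge> 0" using N B CF CG by (simp add: K_def)
    fix \<gamma> S
    assume *: "\<forall>t\<in>S. \<gamma> t \<in> D \<and>
       (\<gamma> has_vector_derivative (\<Sum>i\<in>I. v i t *\<^sub>R X i (\<gamma> t))) (at t within S)"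
    note \<gamma> = bspec[OF *]
    define X' where "X' t = (\<Sum>i\<in>I. v i t *\<^sub>R X i (\<gamma> t))" for t
    have X': "norm (X' t) \<le> N * (B * B) * \<sigma> (\<gamma> t) ^ 2" if "t \<in> S" for t
    proof -
      have "norm (X' t) \<le> (\<Sum>i\<in>I. \<bar>v i t\<bar> * norm (X i (\<gamma> t)))"
        unfolding X'_def by (rule order_trans[OF norm_sum]) simp
      also have "\<dots> \<le> (\<Sum>i\<in>I. B * (B * \<sigma> (\<gamma> t) ^ 2))"
      proof (intro sum_mono mult_mono)
        fix i assume "i \<in> I"
        then show "norm (X i (\<gamma> t)) \<le> B * \<sigma> (\<gamma> t) ^ 2"
          using X[of i "\<gamma> t"] \<gamma>[OF that] B by (meson mult_right_mono order_trans zero_le_power2)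
        show "\<bar>v i t\<bar> \<le> B" using v[OF \<open>i \<in> I\<close>, of t] B by linarith
      qed (use B in auto)
      finally show ?thesis by (simp add: N_def mult_ac)
    qed
    define z where "z t = \<psi> (\<gamma> t) - (\<Sum>i\<in>I. V i t * F i (\<gamma> t)) + (\<Sum>i\<in>I. \<Sum>j\<in>I. W i j t * G i j (\<gamma> t))" for t
    define z' where "z' t = \<psi>' (\<gamma> t) (X' t) - (\<Sum>i\<in>I. v i t * F i (\<gamma> t) + F' i (\<gamma> t) (X' t) * V i t)
      + (\<Sum>i\<in>I. \<Sum>j\<in>I. (V i t * v j t - m i j) * G i j (\<gamma> t) + G' i j (\<gamma> t) (X' t) * W i j t)" for t
    show "\<exists>z z'. \<forall>t\<in>S. (z has_real_derivative z' t) (at t within S) \<and>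
       \<bar>z t - \<psi> (\<gamma> t)\<bar> \<le> K * \<sigma> (\<gamma> t) ^ 3 \<and>
       \<bar>z' t + (\<Sum>i\<in>I. \<Sum>j\<in>I. m i j * G i j (\<gamma> t))\<bar> \<le> K * \<sigma> (\<gamma> t) ^ 5"
    proof (intro exI ballI conjI)
      fix t assume t: "t \<in> S"
      have D: "\<gamma> t \<in> D" and \<gamma>': "(\<gamma> has_vector_derivative X' t) (at t within S)"
        using \<gamma>[OF t] by (auto simp: X'_def)
      have s: "0 < \<sigma> (\<gamma> t)" "\<sigma> (\<gamma> t) \<le> 1" using \<sigma>[OF D] by auto
      show "(z has_real_derivative z' t) (at t within S)"
        unfolding z_def[abs_def] z'_def
        by (intro DERIV_add DERIV_diff DERIV_sum DERIV_mult DERIV_along_curve[OF _ \<gamma>'] \<psi> F' G2 D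
            DERIV_subset[OF V(2)] DERIV_subset[OF W(2)] subset_UNIV)
      have "\<bar>\<Sum>i\<in>I. V i t * F i (\<gamma> t)\<bar> \<le> (\<Sum>i\<in>I. B * (CF * \<sigma> (\<gamma> t) ^ 3))"
        using order_trans[OF V(1) B(2)] B
        by (intro order_trans[OF sum_abs] sum_mono) (auto simp: abs_mult intro!: mult_mono CF D)
      moreover have "\<bar>\<Sum>i\<in>I. \<Sum>j\<in>I. W i j t * G i j (\<gamma> t)\<bar> \<le> (\<Sum>i\<in>I. \<Sum>j\<in>I. B * (CG * \<sigma> (\<gamma> t) ^ 4))"
        using order_trans[OF W(1) B(2)] B
        by (intro order_trans[OF sum_abs] sum_mono) (auto simp: abs_mult intro!: mult_mono G1 D)
      \<comment> \<open>Because \<open>\<sigma>\<close> is at most 1, the fourth-order corrector is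
        absorbed into the third order.\<close>
      moreover have "(\<Sum>i\<in>I. \<Sum>j\<in>I. B * (CG * \<sigma> (\<gamma> t) ^ 4)) \<le> (\<Sum>i\<in>I. \<Sum>j\<in>I. B * (CG * \<sigma> (\<gamma> t) ^ 3))"
        using B CG(1) s by (intro sum_mono mult_left_mono power_decreasing) auto
      ultimately have "\<bar>z t - \<psi> (\<gamma> t)\<bar> \<le> N * (B * (CF * \<sigma> (\<gamma> t) ^ 3)) + N * (N * (B * (CG * \<sigma> (\<gamma> t) ^ 3)))"
        by (simp add: z_def N_def)
      also have "\<dots> \<le> K * \<sigma> (\<gamma> t) ^ 3"
        using N B CF(1) CG(1) s by (simp add: K_def algebra_simps)
      finally show "\<bar>z t - \<psi> (\<gamma> t)\<bar> \<le> K * \<sigma> (\<gamma> t) ^ 3" .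
      have \<psi>X: "\<psi>' (\<gamma> t) (X' t) = (\<Sum>i\<in>I. v i t * F i (\<gamma> t))"
      proof -
        interpret bounded_linear "\<psi>' (\<gamma> t)" using \<psi>[OF D] by (rule has_derivative_bounded_linear)
        show ?thesis by (simp add: X'_def sum scaleR F[OF D])
      qed
      have FX: "F' i (\<gamma> t) (X' t) = (\<Sum>j\<in>I. v j t * G i j (\<gamma> t))" if "i \<in> I" for i
      proof -
        interpret bounded_linear "F' i (\<gamma> t)" using F'[OF D that] by (rule has_derivative_bounded_linear)
        show ?thesis using that by (simp add: X'_def sum scaleR G[OF D])
      qed
      \<comment> \<open>Two cancellations: the sum of the \<open>v i * F i\<close> removes the
        derivative of \<open>\<psi>\<close>, and the products \<open>V i * v j * G i j\<close>
        coming from the derivatives of \<open>F i\<close> are removed by the derivatives of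
        \<open>W i j\<close>. What is left is minus the mean plus the terms with
        \<open>G'\<close>.\<close>
      have "z' t + (\<Sum>i\<in>I. \<Sum>j\<in>I. m i j * G i j (\<gamma> t)) = (\<Sum>i\<in>I. \<Sum>j\<in>I. G' i j (\<gamma> t) (X' t) * W i j t)"
        unfolding z'_def \<psi>X
        by (simp add: FX sum.distrib sum_subtractf left_diff_distrib right_diff_distrib sum_distrib_left sum_distrib_right mult_ac)
      also have "\<bar>\<dots>\<bar> \<le> (\<Sum>i\<in>I. \<Sum>j\<in>I. \<bar>G' i j (\<gamma> t) (X' t) * W i j t\<bar>)"
        by (rule order_trans[OF sum_abs sum_mono[OF sum_abs]])
      also have "\<dots> \<le> (\<Sum>i\<in>I. \<Sum>j\<in>I. (CG * \<sigma> (\<gamma> t) ^ 3 * (N * (B * B) * \<sigma> (\<gamma> t) ^ 2)) * B)"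
      proof (intro sum_mono)
        fix i j assume ij: "i \<in> I" "j \<in> I"
        have "\<bar>G' i j (\<gamma> t) (X' t)\<bar> \<le> CG * \<sigma> (\<gamma> t) ^ 3 * (N * (B * B) * \<sigma> (\<gamma> t) ^ 2)"
          using CG(1) s by (intro order_trans[OF G3[OF ij D]] mult_left_mono X' t) auto
        moreover have "\<bar>W i j t\<bar> \<le> B" using W(1)[OF ij] B order_trans by blast
        ultimately show "\<bar>G' i j (\<gamma> t) (X' t) * W i j t\<bar> \<le> (CG * \<sigma> (\<gamma> t) ^ 3 * (N * (B * B) * \<sigma> (\<gamma> t) ^ 2)) * B"
          unfolding abs_mult by (intro mult_mono) (use CG(1) s B N in auto)
      qed
      also have "\<dots> = N * (N * (B * (CG * (N * (B * B))))) * \<sigma> (\<gamma> t) ^ 5"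
        by (simp add: N_def numeral_eq_Suc)
      also have "\<dots> \<le> K * \<sigma> (\<gamma> t) ^ 5"
        using N B CF(1) CG(1) s by (intro mult_right_mono) (auto simp: K_def)
      finally show "\<bar>z' t + (\<Sum>i\<in>I. \<Sum>j\<in>I. m i j * G i j (\<gamma> t))\<bar> \<le> K * \<sigma> (\<gamma> t) ^ 5" .
    qed
  qed
qed

section \<open>Differential equations and inequalities\<close>

lemma global_ode_solution:
  fixes F :: "real \<Rightarrow> 'a::euclidean_space \<Rightarrow> 'a"
  assumes lip: "\<And>t. L-lipschitz_on UNIV (F t)"
    and cont: "\<And>x. continuous_on UNIV (\<lambda>t. F t x)"
    and bound: "\<And>t x. norm (F t x) \<le> M"
  shows "\<exists>\<gamma>. \<gamma> t0 = x0 \<and> (\<forall>t\<ge>t0. (\<gamma> has_vector_derivative F t (\<gamma> t)) (at t within {t0..}))"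
proof -
  have L: "L \<ge> 0" using lip by (rule lipschitz_on_nonneg)
  have M: "M \<ge> 0" using bound[of 0 0] norm_ge_zero order_trans by blast
  \<comment> \<open>Picard iteration on \<open>g\<close>, where \<open>\<gamma> t = x0 + exp (K * (t - t0)) *\<^sub>R g t\<close>: the exponential weight makes it
    a contraction on the whole half-line. Clamping the time at \<open>t0\<close> extends it to all reals.\<close>
  define K where "K = 2 * L + 1"
  \<comment> \<open>The summand 1 in \<open>K\<close> keeps it positive when \<open>L = 0\<close>;
    the ratio 1/2 becomes the contraction factor.\<close>
  have K: "K > 0" "L / K \<le> 1 / 2" using L by (auto simp: K_def field_simps)
  define \<Phi> where "\<Phi> g s = F s (x0 + exp (K * (s - t0)) *\<^sub>R g s)" for g s
  define J where "J g u = integral {t0..u} (\<Phi> g)" for g u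
  define P where "P g t = exp (- K * (max t0 t - t0)) *\<^sub>R J g (max t0 t)" for g t
  have \<Phi>_cont: "continuous_on S (\<Phi> g)" if "continuous_on UNIV g" for g S
  proof -
    define y where "y s = x0 + exp (K * (s - t0)) *\<^sub>R g s" for s
    have y: "continuous_on UNIV y" unfolding y_def using that by (intro continuous_intros)
    \<comment> \<open>Continuity of the composite: freeze the state at \<open>y s\<close> and
      control the difference by the Lipschitz constant, which is uniform in time.\<close>
    have "continuous (at s) (\<lambda>r. F r (y r))" for s
      unfolding isCont_def
    proof (rule Lim_transform2)
      show "((\<lambda>r. F r (y s)) \<longlongrightarrow> F s (y s)) (at s)"
        using cont by (simp add: continuous_on_eq_continuous_at isCont_def)
      have "((\<lambda>r. L * dist (y s) (y r)) \<longlongrightarrow> L * dist (y s) (y s)) (at s)"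
        using y by (intro tendsto_intros) (simp add: continuous_on_eq_continuous_at isCont_def)
      then have "((\<lambda>r. L * dist (y s) (y r)) \<longlongrightarrow> 0) (at s)" by simp
      then show "((\<lambda>r. F r (y s) - F r (y r)) \<longlongrightarrow> 0) (at s)"
        by (rule Lim_null_comparison[rotated])
           (use lipschitz_onD[OF lip] in \<open>auto simp: dist_norm\<close>)
    qed
    then show ?thesis
      by (auto simp: \<Phi>_def[abs_def] y_def intro: continuous_at_imp_continuous_on)
  qed
  have J_deriv: "(J g has_vector_derivative \<Phi> g t) (at t within {t0..})"
    if "continuous_on UNIV g" "t \<ge> t0" for g t
  proof -
    have "(J g has_vector_derivative \<Phi> g t) (at t within {t0..t+1})"
      unfolding J_def[abs_def] using that by (intro integral_has_vector_derivative \<Phi>_cont) auto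
    moreover have "at t within {t0..t+1} = at t within {t0..}"
      by (rule at_within_nhd[of _ "{..<t+1}"]) auto
    ultimately show ?thesis by simp
  qed
  have J_bound: "norm (J g u) \<le> M * (u - t0)" if "continuous_on UNIV g" "u \<ge> t0" for g u
    unfolding J_def using that
    by (intro integral_bound \<Phi>_cont) (auto simp: \<Phi>_def bound)
  have P_bcont: "P g \<in> bcontfun" if "continuous_on UNIV g" for g
  proof -
    have "continuous_on {t0..} (J g)"
      using J_deriv[OF that] has_vector_derivative_continuous
      by (fastforce simp: continuous_on_eq_continuous_within)
    then have "continuous_on UNIV (\<lambda>t. J g (max t0 t))"
      by (rule continuous_on_compose2) (auto intro!: continuous_intros)
    then have "continuous_on UNIV (P g)"
      unfolding P_def[abs_def] by (intro continuous_intros)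
    \<comment> \<open>As \<open>F\<close> is bounded, the integral grows at most linearly, and the
      exponential weight outweighs that. This keeps the iteration inside the bounded continuous
      functions.\<close>
    moreover have "norm (P g t) \<le> M / K" for t
    proof -
      define \<tau> where "\<tau> = max t0 t - t0"
      have \<tau>: "\<tau> \<ge> 0" by (simp add: \<tau>_def)
      have "norm (P g t) \<le> exp (- (K * \<tau>)) * (M * \<tau>)"
        using J_bound[OF that, of "max t0 t"] by (simp add: P_def \<tau>_def)
      also have "\<dots> = M * (\<tau> / exp (K * \<tau>))" by (simp add: exp_minus field_simps)
      also have "\<tau> / exp (K * \<tau>) \<le> 1 / K"
      proof -
        have "K * \<tau> \<le> exp (K * \<tau>)"
          using exp_ge_add_one_self[of "K * \<tau>"] by linarith
        then show ?thesis using K by (simp add: field_simps)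
      qed
      finally show ?thesis using M by (simp add: mult_left_mono)
    qed
    ultimately show ?thesis
      unfolding bcontfun_def by (auto intro!: boundedI)
  qed
  have P_diff: "norm (P g t - P h t) \<le> 1 / 2 * d"
    if gh: "continuous_on UNIV g" "continuous_on UNIV h" and d: "\<And>s. norm (g s - h s) \<le> d" for g h d t
  proof -
    define u where "u = max t0 t"
    have u: "u \<ge> t0" by (simp add: u_def)
    have d0: "d \<ge> 0" using d norm_ge_zero order_trans by blast
    have e: "((\<lambda>s. L * d * exp (K * (s - t0))) has_integral
        (L * d / K * exp (K * (u - t0)) - L * d / K * exp (K * (t0 - t0)))) {t0..u}"
      by (rule fundamental_theorem_of_calculus[OF u])
         (use K in \<open>auto intro!: derivative_eq_intros simp: has_real_derivative_iff_has_vector_derivative[symmetric]\<close>)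
    have "norm (J g u - J h u) = norm (integral {t0..u} (\<lambda>s. \<Phi> g s - \<Phi> h s))"
      unfolding J_def by (subst integral_diff) (auto intro!: integrable_continuous_interval \<Phi>_cont gh)
    also have "\<dots> \<le> integral {t0..u} (\<lambda>s. L * d * exp (K * (s - t0)))"
    proof (rule integral_norm_bound_integral)
      show "(\<lambda>s. \<Phi> g s - \<Phi> h s) integrable_on {t0..u}"
        by (intro integrable_continuous_interval continuous_intros \<Phi>_cont gh)
      show "(\<lambda>s. L * d * exp (K * (s - t0))) integrable_on {t0..u}"
        using e by blast
      fix s
      have "norm (\<Phi> g s - \<Phi> h s) \<le> L * (exp (K * (s - t0)) * norm (g s - h s))"
        using lipschitz_onD[OF lip, of "x0 + exp (K * (s - t0)) *\<^sub>R g s" "x0 + exp (K * (s - t0)) *\<^sub>R h s"]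
        by (simp add: \<Phi>_def dist_norm scaleR_diff_right[symmetric])
      also have "\<dots> \<le> L * (exp (K * (s - t0)) * d)"
        using L d by (intro mult_left_mono) auto
      finally show "norm (\<Phi> g s - \<Phi> h s) \<le> L * d * exp (K * (s - t0))"
        by (simp add: mult_ac)
    qed
    also have "\<dots> = L / K * d * (exp (K * (u - t0)) - 1)"
      using integral_unique[OF e] K by (simp add: field_simps)
    also have "\<dots> \<le> 1 / 2 * d * exp (K * (u - t0))"
      using K L d0 u by (intro mult_mono) auto
    finally have "norm (J g u - J h u) \<le> 1 / 2 * d * exp (K * (u - t0))" .
    then have "exp (- K * (u - t0)) * norm (J g u - J h u)
        \<le> exp (- K * (u - t0)) * (1 / 2 * d * exp (K * (u - t0)))"
      by (intro mult_left_mono) auto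
    also have "\<dots> = 1 / 2 * d"
      by (simp add: exp_minus)
    finally show ?thesis
      by (simp add: P_def u_def scaleR_diff_right[symmetric])
  qed
  define \<T> where "\<T> g = Bcontfun (P (apply_bcontfun g))" for g :: "real \<Rightarrow>\<^sub>C 'a"
  have \<T>: "apply_bcontfun (\<T> g) = P (apply_bcontfun g)" for g
    unfolding \<T>_def by (rule Bcontfun_inverse) (rule P_bcont, simp)
  have "\<exists>!g. \<T> g = g"
  proof (rule banach_fix_type[of "1/2"])
    have "norm (P (apply_bcontfun g) t - P (apply_bcontfun h) t) \<le> 1 / 2 * dist g h"
      for g h :: "real \<Rightarrow>\<^sub>C 'a" and t
      using dist_bounded[of g _ h] by (intro P_diff) (auto simp: dist_norm)
    then show "\<forall>g h. dist (\<T> g) (\<T> h) \<le> 1 / 2 * dist g h"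
      by (intro allI dist_bound) (simp add: \<T> dist_norm[of "P _ _"])
  qed auto
  then obtain g where g: "\<T> g = g" by blast
  define \<gamma> where "\<gamma> t = x0 + exp (K * (t - t0)) *\<^sub>R apply_bcontfun g t" for t
  have \<gamma>J: "\<gamma> t = x0 + J g t" if "t \<ge> t0" for t
  proof -
    have "apply_bcontfun g t = exp (- K * (t - t0)) *\<^sub>R J g t"
      using fun_cong[OF \<T>[of g], of t] that by (simp add: g P_def max_def)
    then show ?thesis by (simp add: \<gamma>_def exp_minus)
  qed
  show ?thesis
  proof (intro exI[of _ \<gamma>] conjI allI impI)
    show "\<gamma> t0 = x0" by (simp add: \<gamma>J J_def)
    fix t assume t: "t \<ge> t0"
    have "((\<lambda>t. x0 + J g t) has_vector_derivative \<Phi> g t) (at t within {t0..})"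
      using J_deriv[OF _ t, of "apply_bcontfun g"] by (auto intro!: derivative_eq_intros)
    moreover have "\<Phi> g t = F t (\<gamma> t)" by (simp add: \<Phi>_def \<gamma>_def)
    ultimately show "(\<gamma> has_vector_derivative F t (\<gamma> t)) (at t within {t0..})"
      using has_vector_derivative_transform[of t "{t0..}" \<gamma> "\<lambda>t. x0 + J g t"] t \<gamma>J by simp
  qed
qed

section \<open>Scalar differential inequalities on compact intervals\<close>

lemma real_within_increasing:
  fixes g :: "real \<Rightarrow> real"
  assumes "a \<le> b" and g: "\<And>t. t \<in> {a..b} \<Longrightarrow> (g has_real_derivative g' t) (at t within {a..b})"
    and "\<And>t. t \<in> {a..b} \<Longrightarrow> g' t \<ge> 0"
  shows "g a \<le> g b"
proof (rule DERIV_nonneg_imp_increasing_open[OF \<open>a \<le> b\<close>])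
  show "continuous_on {a..b} g"
    using g by (rule DERIV_continuous_on)
  fix x assume "a < x" "x < b"
  then show "\<exists>y. (g has_real_derivative y) (at x) \<and> y \<ge> 0"
    using g[of x] assms(3)[of x] at_within_Icc_at[of a x b] by auto
qed

text \<open>Taking the reciprocal makes the inequality linear: the derivative of
  \<open>1 / z\<close> is \<open>- z' / z^2\<close>, hence at least \<open>c\<close>.\<close>

lemma riccati_decay:
  fixes z :: "real \<Rightarrow> real"
  assumes "a \<le> b" and z: "\<And>t. t \<in> {a..b} \<Longrightarrow> (z has_real_derivative z' t) (at t within {a..b})"
    and pos: "\<And>t. t \<in> {a..b} \<Longrightarrow> z t > 0"
    and le: "\<And>t. t \<in> {a..b} \<Longrightarrow> z' t \<le> - c * (z t)\<^sup>2"
  shows "1 / z a + c * (b - a) \<le> 1 / z b"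
proof -
  have "1 / z a - c * a \<le> 1 / z b - c * b"
  proof (rule real_within_increasing[OF \<open>a \<le> b\<close>])
    fix t assume t: "t \<in> {a..b}"
    show "((\<lambda>t. 1 / z t - c * t) has_real_derivative (- z' t / (z t)\<^sup>2 - c)) (at t within {a..b})"
      using pos[OF t] by (auto intro!: derivative_eq_intros z[OF t] simp: power2_eq_square)
    show "- z' t / (z t)\<^sup>2 - c \<ge> 0"
      using le[OF t] pos[OF t] by (simp add: field_simps)
  qed
  then show ?thesis by (simp add: algebra_simps)
qed

text \<open>Gronwall in both directions, by integrating factors. Applied to \<open>\<psi>\<close>
  along a solution, the lower bound preserves positivity and the upper bound preserves the value
  zero.\<close>

lemma exponential_bounds:
  fixes y :: "real \<Rightarrow> real"
  assumes "a \<le> b" and y: "\<And>t. t \<in> {a..b} \<Longrightarrow> (y has_real_derivative y' t) (at t within {a..b})"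
    and le: "\<And>t. t \<in> {a..b} \<Longrightarrow> \<bar>y' t\<bar> \<le> C * y t"
  shows "y a * exp (- C * (b - a)) \<le> y b" "y b \<le> y a * exp (C * (b - a))"
proof -
  define e where "e = exp (C * (b - a))"
  have e: "e > 0" "exp (- C * (b - a)) = 1 / e"
    by (simp_all add: e_def exp_minus[symmetric] inverse_eq_divide[symmetric])
  have "y a * exp (C * (a - a)) \<le> y b * exp (C * (b - a))"
  proof (rule real_within_increasing[OF \<open>a \<le> b\<close>])
    fix t assume t: "t \<in> {a..b}"
    show "((\<lambda>t. y t * exp (C * (t - a))) has_real_derivative ((y' t + C * y t) * exp (C * (t - a)))) (at t within {a..b})"
      by (auto intro!: derivative_eq_intros y[OF t] simp: algebra_simps)
    show "(y' t + C * y t) * exp (C * (t - a)) \<ge> 0"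
      using le[OF t] by auto
  qed
  then show "y a * exp (- C * (b - a)) \<le> y b"
    using e(1) unfolding e(2) e_def[symmetric] by (simp add: field_simps)
  have "- (y a * exp (- C * (a - a))) \<le> - (y b * exp (- C * (b - a)))"
  proof (rule real_within_increasing[OF \<open>a \<le> b\<close>])
    fix t assume t: "t \<in> {a..b}"
    show "((\<lambda>t. - (y t * exp (- C * (t - a)))) has_real_derivative ((C * y t - y' t) * exp (- C * (t - a)))) (at t within {a..b})"
      by (auto intro!: derivative_eq_intros y[OF t] simp: algebra_simps)
    show "(C * y t - y' t) * exp (- C * (t - a)) \<ge> 0"
      using le[OF t] by auto
  qed
  then show "y b \<le> y a * exp (C * (b - a))"
    using e(1) unfolding e(2) e_def[symmetric] by (simp add: field_simps)
qed

section \<open>Gain functions\<close>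

lemma admissible_h_DERIV:
  assumes "admissible_h h" "y > 0"
  shows "(h has_real_derivative deriv h y) (at y)"
    "(deriv h has_real_derivative deriv (deriv h) y) (at y)"
  using assms unfolding admissible_h_def
  by (auto intro!: DERIV_deriv_iff_real_differentiable[THEN iffD2])

lemma admissible_h_zero: "admissible_h h \<Longrightarrow> h 0 = 0"
  by (simp add: admissible_h_def)

text \<open>Puts the three bounds near zero under one constant and one radius. The Lipschitz
  property follows from the mean value theorem for positive arguments; at the endpoint 0, where
  \<open>h\<close> may fail to be differentiable, the linear bound takes its place.\<close>

lemma admissible_h_local_bounds:
  assumes h: "admissible_h h"
  obtains M \<delta> where "M > 0" "\<delta> > 0"
    "\<And>y. 0 \<le> y \<Longrightarrow> y < \<delta> \<Longrightarrow> \<bar>h y\<bar> \<le> M * y"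
    "\<And>y. 0 < y \<Longrightarrow> y < \<delta> \<Longrightarrow> \<bar>deriv h y\<bar> \<le> M"
    "\<And>y. 0 < y \<Longrightarrow> y < \<delta> \<Longrightarrow> \<bar>deriv (deriv h) y\<bar> * y \<le> M"
    "M-lipschitz_on {0..<\<delta>} h"
proof -
  from h obtain M1 d1 M2 d2 M3 d3 where *:
    "d1 > 0" "\<And>y. 0 < y \<Longrightarrow> y < d1 \<Longrightarrow> \<bar>h y / y\<bar> \<le> M1"
    "d2 > 0" "\<And>y. 0 < y \<Longrightarrow> y < d2 \<Longrightarrow> \<bar>deriv h y\<bar> \<le> M2"
    "d3 > 0" "\<And>y. 0 < y \<Longrightarrow> y < d3 \<Longrightarrow> \<bar>deriv (deriv h) y * y\<bar> \<le> M3"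
    unfolding admissible_h_def by metis
  define M where "M = \<bar>M1\<bar> + \<bar>M2\<bar> + \<bar>M3\<bar> + 1"
  define \<delta> where "\<delta> = min d1 (min d2 d3)"
  have M: "M > 0" "M1 \<le> M" "M2 \<le> M" "M3 \<le> M"
    by (simp_all add: M_def)
  have b1: "\<bar>h y\<bar> \<le> M * y" if "0 \<le> y" "y < \<delta>" for y
  proof (cases "y = 0")
    case False
    then have "\<bar>h y / y\<bar> \<le> M"
      using *(2)[of y] that M by (simp add: \<delta>_def)
    with False that show ?thesis by (simp add: field_simps)
  qed (simp add: admissible_h_zero[OF h])
  have b2: "\<bar>deriv h y\<bar> \<le> M" if "0 < y" "y < \<delta>" for y
    using *(4)[of y] that M by (simp add: \<delta>_def)
  have mono: "\<bar>h x - h y\<bar> \<le> M * (y - x)" if "0 \<le> x" "x < y" "y < \<delta>" for x y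
  proof (cases "x = 0")
    case True
    then show ?thesis using b1[of y] that by (simp add: admissible_h_zero[OF h])
  next
    case False
    then have "\<exists>z>x. z < y \<and> h y - h x = (y - x) * deriv h z"
      using that by (intro MVT2 admissible_h_DERIV(1)[OF h]) auto
    then obtain \<xi> where \<xi>: "x < \<xi>" "\<xi> < y" "h y - h x = (y - x) * deriv h \<xi>"
      by blast
    then have "\<bar>h x - h y\<bar> = (y - x) * \<bar>deriv h \<xi>\<bar>"
      using that by (simp add: abs_minus_commute[of "h x"] abs_mult)
    also have "\<dots> \<le> (y - x) * M"
      using b2[of \<xi>] \<xi> that by (intro mult_left_mono) auto
    finally show ?thesis by (simp add: mult.commute)
  qed
  show thesis
  proof (rule that[of M \<delta>])
    show "\<delta> > 0" using * by (simp add: \<delta>_def)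
    show "\<bar>deriv (deriv h) y\<bar> * y \<le> M" if "0 < y" "y < \<delta>" for y
      using *(6)[of y] that M by (simp add: \<delta>_def abs_mult)
    show "M-lipschitz_on {0..<\<delta>} h"
    proof (rule lipschitz_onI)
      fix x y assume "x \<in> {0..<\<delta>}" "y \<in> {0..<\<delta>}"
      then show "dist (h x) (h y) \<le> M * dist x y"
        using mono[of x y] mono[of y x] by (cases x y rule: linorder_cases) (auto simp: dist_real_def)
    qed (use M in simp)
  qed (use M b1 b2 in auto)
qed

text \<open>The gradient is merely bounded, so the factor \<open>\<sigma>\<close> in front of the
  derivative is absorbed by \<open>\<sigma> p \<le> 1\<close>.\<close>

lemma symb_smooth:
  fixes f :: "real^'n::finite \<Rightarrow> real"
  assumes f: "smooth_fun f" and K: "compact K" "D \<subseteq> K"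
    and \<sigma>: "\<And>p. p \<in> D \<Longrightarrow> 0 \<le> \<sigma> p \<and> \<sigma> p \<le> 1"
  shows "symb \<sigma> D 0 f"
proof -
  obtain C1 where C1: "C1 > 0" "\<And>p. p \<in> K \<Longrightarrow> norm (f p) \<le> C1"
    using compact_norm_bound[OF K(1) smooth_fun_continuous_on[OF f]] by blast
  obtain C2 where C2: "C2 > 0" "\<And>p. p \<in> K \<Longrightarrow> norm (grad f p) \<le> C2"
    using compact_norm_bound[OF K(1) continuous_on_grad[OF f]] by blast
  show ?thesis
  proof (rule symbI[where C = "C1 + C2" and f' = "\<lambda>p v. grad f p \<bullet> v"])
    fix p v assume p: "p \<in> D"
    then have pK: "p \<in> K" using K by blast
    show "\<bar>f p\<bar> \<le> (C1 + C2) * \<sigma> p ^ 0"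
      using C1(2)[OF pK] C2(1) by simp
    show "(f has_derivative (\<lambda>v. grad f p \<bullet> v)) (at p)"
      by (rule smooth_fun_has_derivative[OF f])
    have "\<sigma> p * \<bar>grad f p \<bullet> v\<bar> \<le> 1 * (norm (grad f p) * norm v)"
      using \<sigma>[OF p] by (intro mult_mono Cauchy_Schwarz_ineq2) auto
    also have "\<dots> \<le> (C1 + C2) * norm v"
      using C2(2)[OF pK] C1(1) by (simp add: mult_right_mono)
    finally show "\<sigma> p * \<bar>grad f p \<bullet> v\<bar> \<le> (C1 + C2) * \<sigma> p ^ 0 * norm v" by simp
  qed (use C1 C2 in auto)
qed

text \<open>A bounded gradient is already the derivative estimate of order 1, so only the size of
  \<open>f\<close> must be assumed. Meant for Lie derivatives of \<open>\<psi>\<close>, which are as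
  small as its gradient.\<close>

lemma symb_one:
  fixes f :: "real^'n::finite \<Rightarrow> real"
  assumes f: "smooth_fun f" and K: "compact K" "D \<subseteq> K"
    and \<sigma>: "\<And>p. p \<in> D \<Longrightarrow> 0 \<le> \<sigma> p"
    and C: "C \<ge> 0" "\<And>p. p \<in> D \<Longrightarrow> \<bar>f p\<bar> \<le> C * \<sigma> p"
  shows "symb \<sigma> D 1 f"
proof -
  obtain C2 where C2: "C2 > 0" "\<And>p. p \<in> K \<Longrightarrow> norm (grad f p) \<le> C2"
    using compact_norm_bound[OF K(1) continuous_on_grad[OF f]] by blast
  show ?thesis
  proof (rule symbI[where C = "C + C2" and f' = "\<lambda>p v. grad f p \<bullet> v"])
    fix p v assume p: "p \<in> D"
    then have pK: "p \<in> K" using K by blast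
    have "C * \<sigma> p \<le> (C + C2) * \<sigma> p"
      using \<sigma>[OF p] C2(1) by (intro mult_right_mono) auto
    with C(2)[OF p] show "\<bar>f p\<bar> \<le> (C + C2) * \<sigma> p ^ 1" by simp
    show "(f has_derivative (\<lambda>v. grad f p \<bullet> v)) (at p)"
      by (rule smooth_fun_has_derivative[OF f])
    have "\<sigma> p * \<bar>grad f p \<bullet> v\<bar> \<le> \<sigma> p * (norm (grad f p) * norm v)"
      using \<sigma>[OF p] by (intro mult_mono Cauchy_Schwarz_ineq2) auto
    also have "\<dots> \<le> \<sigma> p * ((C + C2) * norm v)"
      using C2(2)[OF pK] C(1) \<sigma>[OF p] by (intro mult_left_mono mult_right_mono) auto
    finally show "\<sigma> p * \<bar>grad f p \<bullet> v\<bar> \<le> (C + C2) * \<sigma> p ^ 1 * norm v" by (simp add: mult_ac)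
  qed (use C C2 in auto)
qed

text \<open>By the chain rule the derivative is \<open>g'\<close> times a gradient of size
  \<open>\<sigma>\<close>; with the factor \<open>\<sigma>\<close> from the symbol estimate this
  makes \<open>g' y * y\<close>, which is how condition (v) enters. It serves \<open>h\<close> with
  \<open>n = 1\<close> and \<open>deriv h\<close> with \<open>n = 0\<close>.\<close>

lemma symb_compose:
  fixes g :: "real \<Rightarrow> real" and \<psi> :: "real^'n::finite \<Rightarrow> real"
  assumes \<psi>: "smooth_fun \<psi>"
    and \<sigma>: "\<And>p. p \<in> D \<Longrightarrow> 0 < \<psi> p \<and> \<psi> p < \<delta> \<and> \<sigma> p = sqrt (\<psi> p)"
    and C: "C \<ge> 0" "\<And>p. p \<in> D \<Longrightarrow> norm (grad \<psi> p) \<le> C * \<sigma> p"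
    and g: "\<And>y. 0 < y \<Longrightarrow> y < \<delta> \<Longrightarrow> (g has_real_derivative g' y) (at y)"
    and M: "M \<ge> 0" "\<And>y. 0 < y \<Longrightarrow> y < \<delta> \<Longrightarrow> \<bar>g y\<bar> \<le> M * y ^ n"
      "\<And>y. 0 < y \<Longrightarrow> y < \<delta> \<Longrightarrow> \<bar>g' y\<bar> * y \<le> M * y ^ n"
  shows "symb \<sigma> D (2 * n) (\<lambda>p. g (\<psi> p))"
proof (rule symbI[where C = "M + M * C" and f' = "\<lambda>p v. g' (\<psi> p) * (grad \<psi> p \<bullet> v)"])
  fix p v assume p: "p \<in> D"
  have y: "0 < \<psi> p" "\<psi> p < \<delta>" "\<sigma> p \<ge> 0" "(\<sigma> p)\<^sup>2 = \<psi> p" using \<sigma>[OF p] by auto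
  have yn: "\<sigma> p ^ (2 * n) = \<psi> p ^ n" by (simp add: power_mult y(4))
  have MC: "0 \<le> M * C * \<psi> p ^ n" "0 \<le> M * \<psi> p ^ n"
    using M(1) C(1) y by simp_all
  show "\<bar>g (\<psi> p)\<bar> \<le> (M + M * C) * \<sigma> p ^ (2 * n)"
    using M(2)[OF y(1,2)] MC by (simp add: yn distrib_right)
  show "((\<lambda>p. g (\<psi> p)) has_derivative (\<lambda>v. g' (\<psi> p) * (grad \<psi> p \<bullet> v))) (at p)"
    using has_derivative_compose[OF smooth_fun_has_derivative[OF \<psi>]
        g[OF y(1,2), unfolded has_field_derivative_def]] .
  have "\<sigma> p * \<bar>g' (\<psi> p) * (grad \<psi> p \<bullet> v)\<bar> = \<bar>g' (\<psi> p)\<bar> * (\<sigma> p * \<bar>grad \<psi> p \<bullet> v\<bar>)"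
    by (simp add: abs_mult)
  also have "\<dots> \<le> \<bar>g' (\<psi> p)\<bar> * (\<sigma> p * (C * \<sigma> p * norm v))"
    using y(3) C(2)[OF p]
    by (intro mult_left_mono order_trans[OF Cauchy_Schwarz_ineq2] mult_right_mono) auto
  also have "\<dots> = C * (\<bar>g' (\<psi> p)\<bar> * \<psi> p) * norm v"
    by (simp add: y(4)[symmetric] power2_eq_square)
  also have "\<dots> \<le> C * (M * \<psi> p ^ n) * norm v"
    using C(1) M(3)[OF y(1,2)] by (intro mult_right_mono mult_left_mono) auto
  also have "\<dots> \<le> (M + M * C) * \<psi> p ^ n * norm v"
    using MC by (intro mult_right_mono) (simp_all add: algebra_simps)
  finally show "\<sigma> p * \<bar>g' (\<psi> p) * (grad \<psi> p \<bullet> v)\<bar> \<le> (M + M * C) * \<sigma> p ^ (2 * n) * norm v"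
    by (simp add: yn)
qed (use M C in auto)

text \<open>Smallness keeps \<open>z\<close> between 4/5 and 6/5 of \<open>y\<close>, so decay of
  \<open>z\<close> is decay of \<open>y\<close>. Half of \<open>c\<close> is spent on the remainder
  of order 5, and half of the rest on replacing \<open>y^2\<close> by \<open>z^2\<close>, which is
  at most \<open>2 * y^2\<close>; this leaves \<open>c / 4\<close>.\<close>

lemma perturbed_riccati_decay:
  fixes y z :: "real \<Rightarrow> real"
  assumes "a \<le> b" and y: "\<And>t. t \<in> {a..b} \<Longrightarrow> 0 < y t"
    and z: "\<And>t. t \<in> {a..b} \<Longrightarrow> (z has_real_derivative z' t) (at t within {a..b})"
    and zy: "\<And>t. t \<in> {a..b} \<Longrightarrow> \<bar>z t - y t\<bar> \<le> K * sqrt (y t) ^ 3"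
    and z': "\<And>t. t \<in> {a..b} \<Longrightarrow> z' t \<le> - c * sqrt (y t) ^ 4 + K * sqrt (y t) ^ 5"
    and small: "\<And>t. t \<in> {a..b} \<Longrightarrow> K * sqrt (y t) \<le> 1 / 5" "\<And>t. t \<in> {a..b} \<Longrightarrow> K * sqrt (y t) \<le> c / 2"
    and c: "c > 0"
  shows "y b \<le> 2 * y a / (1 + c / 4 * y a * (b - a))"
proof -
  have zy5: "4 / 5 * y t \<le> z t" "z t \<le> 6 / 5 * y t" if t: "t \<in> {a..b}" for t
  proof -
    have "K * sqrt (y t) ^ 3 = (K * sqrt (y t)) * y t"
      using y[OF t] by (simp add: power3_eq_cube)
    also have "\<dots> \<le> 1 / 5 * y t"
      using y[OF t] small(1)[OF t] by (intro mult_right_mono) auto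
    finally show "4 / 5 * y t \<le> z t" "z t \<le> 6 / 5 * y t"
      using zy[OF t] by linarith+
  qed
  have zpos: "z t > 0" if "t \<in> {a..b}" for t
    using zy5(1)[OF that] y[OF that] by linarith
  have "1 / z a + c / 4 * (b - a) \<le> 1 / z b"
  proof (rule riccati_decay[OF \<open>a \<le> b\<close> z zpos])
    fix t assume t: "t \<in> {a..b}"
    have s4: "sqrt (y t) ^ 4 = (y t)\<^sup>2" and s5: "sqrt (y t) ^ 5 = sqrt (y t) * (y t)\<^sup>2"
      using y[OF t] by (simp_all add: numeral_eq_Suc)
    have "z' t \<le> - c * (y t)\<^sup>2 + (K * sqrt (y t)) * (y t)\<^sup>2"
      using z'[OF t] unfolding s4 s5 by simp
    also have "\<dots> \<le> - c * (y t)\<^sup>2 + c / 2 * (y t)\<^sup>2"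
      using small(2)[OF t] by (intro add_left_mono mult_right_mono) auto
    also have "\<dots> = - (c / 2 * (y t)\<^sup>2)" by simp
    also have "\<dots> \<le> - (c / 4 * (z t)\<^sup>2)"
    proof -
      have "(z t)\<^sup>2 \<le> (6 / 5 * y t)\<^sup>2"
        using zpos[OF t] zy5(2)[OF t] by (intro power_mono) auto
      also have "\<dots> \<le> 2 * (y t)\<^sup>2"
        by (simp add: power2_eq_square)
      finally show ?thesis using c by simp
    qed
    finally show "z' t \<le> - (c / 4) * (z t)\<^sup>2" by simp
  qed auto
  then have zb: "1 / z a + c / 4 * (b - a) \<le> 1 / z b" .
  have a: "a \<in> {a..b}" "b \<in> {a..b}" using \<open>a \<le> b\<close> by auto
  define u where "u = c / 4 * (b - a)"
  have u: "u \<ge> 0" using c \<open>a \<le> b\<close> by (simp add: u_def)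
  note pos = y[OF a(1)] y[OF a(2)] zpos[OF a(1)] zpos[OF a(2)]
  have "5 / 6 * (1 / y a) \<le> 1 / z a"
    using pos zy5(2)[OF a(1)] by (simp add: field_simps)
  moreover have "1 / z b \<le> 5 / 4 * (1 / y b)"
    using pos zy5(1)[OF a(2)] by (simp add: field_simps)
  ultimately have "5 / 6 * (1 / y a) + u \<le> 5 / 4 * (1 / y b)"
    using zb by (simp add: u_def)
  \<comment> \<open>Multiplication by 6/5 gives the factor 3/2 on the right; rounding it up to 2
    gives the 2 of the final estimate.\<close>
  then have "1 / y a + u \<le> 2 * (1 / y b)"
  proof -
    have "1 / y a > 0" "1 / y b > 0" using pos(1,2) by simp_all
    with \<open>5 / 6 * (1 / y a) + u \<le> 5 / 4 * (1 / y b)\<close> u show ?thesis by linarith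
  qed
  then have "(1 + u * y a) * y b \<le> 2 * y a"
    using pos(1,2) by (simp add: field_simps)
  moreover have "1 + u * y a > 0"
    using u pos by (simp add: add_pos_nonneg)
  ultimately have "y b \<le> 2 * y a / (1 + u * y a)"
    by (simp add: pos_le_divide_eq mult.commute)
  then show ?thesis by (simp add: u_def mult_ac)
qed

section \<open>Averaging of the closed loop\<close>

definition ctrl_index :: "nat \<Rightarrow> (nat \<times> bool) set" where
  "ctrl_index \<mu> = {1..\<mu>} \<times> UNIV"

text \<open>The index \<open>(k, True)\<close> stands for the cosine term of input \<open>k\<close> (gain \<open>h1\<close>) and \<open>(k, False)\<close> for its sine
  term (gain \<open>h2\<close>), the sine being written as a cosine with shifted phase.\<close>

definition phase :: "(nat \<Rightarrow> real) \<Rightarrow> nat \<times> bool \<Rightarrow> real" where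
  "phase \<phi> i = \<phi> (fst i) - (if snd i then 0 else pi / 2)"

definition dither :: "(nat \<Rightarrow> real) \<Rightarrow> (nat \<Rightarrow> real) \<Rightarrow> nat \<times> bool \<Rightarrow> real \<Rightarrow> real" where
  "dither \<omega> \<phi> i t = sqrt (\<omega> (fst i)) * cos (\<omega> (fst i) * t + phase \<phi> i)"

definition ctrl_field :: "(nat \<Rightarrow> real^'n::finite \<Rightarrow> real^'n) \<Rightarrow> (real^'n \<Rightarrow> real) \<Rightarrow> (bool \<Rightarrow> real \<Rightarrow> real)
    \<Rightarrow> nat \<times> bool \<Rightarrow> real^'n \<Rightarrow> real^'n" where
  "ctrl_field B \<psi> h i p = h (snd i) (\<psi> p) *\<^sub>R B (fst i) p"

lemma finite_ctrl_index: "finite (ctrl_index \<mu>)"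
  by (simp add: ctrl_index_def)

lemma fst_ctrl_index: "i \<in> ctrl_index \<mu> \<Longrightarrow> fst i \<in> {1..\<mu>}"
  by (auto simp: ctrl_index_def)

lemma sum_ctrl_index:
  "(\<Sum>i\<in>ctrl_index \<mu>. f i) = (\<Sum>k=1..\<mu>. f (k, True) + f (k, False))"
proof -
  have "(\<Sum>i\<in>ctrl_index \<mu>. f i) = (\<Sum>k=1..\<mu>. \<Sum>b\<in>UNIV. f (k, b))"
    unfolding ctrl_index_def by (subst sum.cartesian_product) simp
  then show ?thesis by (simp add: UNIV_bool add.commute)
qed

lemma closed_loop_eq_sum:
  "closed_loop \<mu> B \<psi> \<omega> \<phi> (h True) (h False) t p =
     (\<Sum>i\<in>ctrl_index \<mu>. dither \<omega> \<phi> i t *\<^sub>R ctrl_field B \<psi> h i p)"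
proof -
  have "cos (x + (y - pi / 2)) = sin (x + y)" for x y :: real
    using cos_diff[of "x + y" "pi / 2"] by (simp only: add_diff_eq) simp
  then show ?thesis
    by (simp add: closed_loop_def sum_ctrl_index dither_def ctrl_field_def phase_def scaleR_add_left)
qed

lemma dither_bounds:
  assumes "\<forall>k\<in>{1..\<mu>}. \<omega> k > 0"
  obtains A where "A \<ge> 0" "\<And>i t. i \<in> ctrl_index \<mu> \<Longrightarrow> \<bar>dither \<omega> \<phi> i t\<bar> \<le> A"
    "\<And>i t. i \<in> ctrl_index \<mu> \<Longrightarrow> \<bar>sin (\<omega> (fst i) * t + phase \<phi> i) / sqrt (\<omega> (fst i))\<bar> \<le> A"
proof
  define A where "A = (\<Sum>i\<in>ctrl_index \<mu>. sqrt (\<omega> (fst i)) + 1 / sqrt (\<omega> (fst i)))"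
  have pos: "\<omega> (fst i) > 0" if "i \<in> ctrl_index \<mu>" for i
    using assms fst_ctrl_index[OF that] by blast
  then show "A \<ge> 0"
    unfolding A_def by (intro sum_nonneg) (simp add: less_imp_le)
  fix i t assume i: "i \<in> ctrl_index \<mu>"
  have A: "sqrt (\<omega> (fst i)) + 1 / sqrt (\<omega> (fst i)) \<le> A"
    unfolding A_def using i finite_ctrl_index pos
    by (intro member_le_sum[where f = "\<lambda>i. sqrt (\<omega> (fst i)) + 1 / sqrt (\<omega> (fst i))"]) (auto simp: less_imp_le)
  have s: "sqrt (\<omega> (fst i)) > 0" "1 / sqrt (\<omega> (fst i)) > 0" using pos[OF i] by simp_all
  have "\<bar>dither \<omega> \<phi> i t\<bar> \<le> sqrt (\<omega> (fst i)) * 1"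
    unfolding dither_def abs_mult using s by (intro mult_mono) auto
  with A s show "\<bar>dither \<omega> \<phi> i t\<bar> \<le> A" by linarith
  have "\<bar>sin (\<omega> (fst i) * t + phase \<phi> i) / sqrt (\<omega> (fst i))\<bar> \<le> 1 / sqrt (\<omega> (fst i))"
    unfolding abs_divide using s(1) by (intro frac_le) auto
  with A s show "\<bar>sin (\<omega> (fst i) * t + phase \<phi> i) / sqrt (\<omega> (fst i))\<bar> \<le> A" by linarith
qed

lemma dither_primitive:
  assumes "\<omega> (fst i) > 0"
  shows "((\<lambda>t. sin (\<omega> (fst i) * t + phase \<phi> i) / sqrt (\<omega> (fst i))) has_real_derivative dither \<omega> \<phi> i t) (at t)"
proof -
  have "((\<lambda>t. sin (\<omega> (fst i) * t + phase \<phi> i)) has_real_derivative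
      cos (\<omega> (fst i) * t + phase \<phi> i) * \<omega> (fst i)) (at t)"
    by (auto intro!: derivative_eq_intros)
  from DERIV_cdivide[OF this, of "sqrt (\<omega> (fst i))"] assms show ?thesis
    by (simp add: dither_def real_div_sqrt mult.commute times_divide_eq_left[symmetric])
qed

lemma smooth_vf_uniform_bound:
  assumes "\<forall>k\<in>{1..\<mu>}. smooth_vf (B k)" "compact K"
  obtains C where "C > 0" "\<And>i p. i \<in> ctrl_index \<mu> \<Longrightarrow> p \<in> K \<Longrightarrow> norm (B (fst i) p) \<le> C"
proof -
  have "\<forall>k\<in>{1..\<mu>}. \<exists>C. C > 0 \<and> (\<forall>p\<in>K. norm (B k p) \<le> C)"
    using compact_norm_bound[OF assms(2) smooth_vf_continuous_on] assms(1) by metis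
  from bchoice[OF this] obtain c where c: "\<forall>k\<in>{1..\<mu>}. c k > 0 \<and> (\<forall>p\<in>K. norm (B k p) \<le> c k)"
    by (rule exE)
  show thesis
  proof (rule that[of "1 + (\<Sum>k=1..\<mu>. c k)"])
    have "0 \<le> (\<Sum>k=1..\<mu>. c k)" using c by (intro sum_nonneg) (simp add: less_imp_le)
    then show "1 + (\<Sum>k=1..\<mu>. c k) > 0" by simp
    fix i :: "nat \<times> bool" and p assume i: "i \<in> ctrl_index \<mu>" and p: "p \<in> K"
    note k = fst_ctrl_index[OF i]
    have "c (fst i) \<le> (\<Sum>k=1..\<mu>. c k)"
      using c k by (intro member_le_sum) (auto simp: less_imp_le)
    moreover have "norm (B (fst i) p) \<le> c (fst i)" using c k p by blast
    ultimately show "norm (B (fst i) p) \<le> 1 + (\<Sum>k=1..\<mu>. c k)" by simp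
  qed
qed

lemma ctrl_field_bound:
  assumes "\<And>b y. 0 \<le> y \<Longrightarrow> y < \<delta> \<Longrightarrow> \<bar>h b y\<bar> \<le> M * y" "0 \<le> \<psi> p" "\<psi> p < \<delta>"
    and "norm (B (fst i) p) \<le> C" "M \<ge> 0"
  shows "norm (ctrl_field B \<psi> h i p) \<le> M * C * \<psi> p"
proof -
  have "norm (ctrl_field B \<psi> h i p) \<le> (M * \<psi> p) * C"
    unfolding ctrl_field_def norm_scaleR using assms by (intro mult_mono) auto
  then show ?thesis by (simp add: mult_ac)
qed

text \<open>The averaging lemma with weight \<open>sqrt \<psi>\<close>, on a set \<open>D\<close>
  avoiding the zeros of \<open>\<psi>\<close> so that the gains are differentiable along it.
  Distinct frequencies decouple the inputs, and within one input only the interaction of sine and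
  cosine has nonzero mean; the hypothesis \<open>wronskian\<close> then fixes the sign of the mean
  and \<open>\<kappa>\<close> its size.\<close>

lemma closed_loop_averaging:
  fixes B :: "nat \<Rightarrow> real^'n::finite \<Rightarrow> real^'n" and h :: "bool \<Rightarrow> real \<Rightarrow> real"
  assumes B: "\<forall>k\<in>{1..\<mu>}. smooth_vf (B k)" and \<psi>: "smooth_fun \<psi>"
    and \<omega>: "\<forall>k\<in>{1..\<mu>}. \<omega> k > 0" "inj_on \<omega> {1..\<mu>}"
    and h: "\<And>b. admissible_h (h b)"
    and M: "M > 0" "\<And>b y. 0 \<le> y \<Longrightarrow> y < \<delta> \<Longrightarrow> \<bar>h b y\<bar> \<le> M * y"
      "\<And>b y. 0 < y \<Longrightarrow> y < \<delta> \<Longrightarrow> \<bar>deriv (h b) y\<bar> \<le> M"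
      "\<And>b y. 0 < y \<Longrightarrow> y < \<delta> \<Longrightarrow> \<bar>deriv (deriv (h b)) y\<bar> * y \<le> M"
    and wronskian: "c > 0" "\<And>y. 0 < y \<Longrightarrow> y < \<delta> \<Longrightarrow>
      deriv (h False) y * h True y - deriv (h True) y * h False y \<le> - c * y"
    and D: "compact K0" "D \<subseteq> K0" "\<And>p. p \<in> D \<Longrightarrow> 0 < \<psi> p \<and> \<psi> p < \<delta> \<and> \<psi> p \<le> 1"
    and grad: "C \<ge> 0" "\<And>p. p \<in> D \<Longrightarrow> norm (grad \<psi> p) \<le> C * sqrt (\<psi> p)"
    and \<kappa>: "\<And>p. p \<in> D \<Longrightarrow> \<kappa> * \<psi> p \<le> (\<Sum>k=1..\<mu>. (lie (B k) \<psi> p)\<^sup>2)"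
  shows "\<exists>K\<ge>0. \<forall>\<gamma> S. (\<forall>t\<in>S. \<gamma> t \<in> D \<and>
       (\<gamma> has_vector_derivative closed_loop \<mu> B \<psi> \<omega> \<phi> (h True) (h False) t (\<gamma> t)) (at t within S)) \<longrightarrow>
     (\<exists>z z'. \<forall>t\<in>S. (z has_real_derivative z' t) (at t within S) \<and>
       \<bar>z t - \<psi> (\<gamma> t)\<bar> \<le> K * sqrt (\<psi> (\<gamma> t)) ^ 3 \<and>
       z' t \<le> - (c * \<kappa> / 2) * sqrt (\<psi> (\<gamma> t)) ^ 4 + K * sqrt (\<psi> (\<gamma> t)) ^ 5)"
proof -
  define I where "I = ctrl_index \<mu>"
  define \<sigma> where "\<sigma> p = sqrt (\<psi> p)" for p
  define v where "v = dither \<omega> \<phi>"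
  define V where "V i t = sin (\<omega> (fst i) * t + phase \<phi> i) / sqrt (\<omega> (fst i))" for i t
  define X where "X = ctrl_field B \<psi> h"
  define F where "F i p = h (snd i) (\<psi> p) * lie (B (fst i)) \<psi> p" for i p
  define F' where "F' i p w = h (snd i) (\<psi> p) * (grad (lie (B (fst i)) \<psi>) p \<bullet> w) +
    (deriv (h (snd i)) (\<psi> p) * (grad \<psi> p \<bullet> w)) * lie (B (fst i)) \<psi> p" for i p w
  \<comment> \<open>The derivative of \<open>F i\<close> along the control field \<open>X j\<close>,
    written out with Lie derivatives.\<close>
  define G where "G i j p = h (snd j) (\<psi> p) *
    (h (snd i) (\<psi> p) * lie (B (fst j)) (lie (B (fst i)) \<psi>) p +
     (deriv (h (snd i)) (\<psi> p) * lie (B (fst j)) \<psi> p) * lie (B (fst i)) \<psi> p)" for i j p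
  \<comment> \<open>The time mean of \<open>V i * v j\<close>, as computed in
    \<open>bounded_primitive_product\<close>.\<close>
  define m where "m i j = (if \<omega> (fst i) = \<omega> (fst j) then sin (phase \<phi> i - phase \<phi> j) / 2 else 0)" for i j
  have \<sigma>: "0 < \<sigma> p \<and> \<sigma> p \<le> 1" "\<sigma> p \<ge> 0" "(\<sigma> p)\<^sup>2 = \<psi> p" if "p \<in> D" for p
    using D(3)[OF that] by (auto simp: \<sigma>_def)
  have \<omega>I: "\<omega> (fst i) > 0" and BI: "smooth_vf (B (fst i))" if "i \<in> I" for i
    using \<omega>(1) B fst_ctrl_index that unfolding I_def by blast+
  obtain A1 where A1: "A1 \<ge> 0" "\<And>i t. i \<in> I \<Longrightarrow> \<bar>v i t\<bar> \<le> A1" "\<And>i t. i \<in> I \<Longrightarrow> \<bar>V i t\<bar> \<le> A1"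
    using dither_bounds[OF \<omega>(1), of \<phi>] unfolding I_def v_def V_def by blast
  have "\<forall>ij\<in>I \<times> I. \<exists>WC. (\<forall>t. \<bar>fst WC t\<bar> \<le> snd WC) \<and>
    (\<forall>t. (fst WC has_real_derivative V (fst ij) t * v (snd ij) t - m (fst ij) (snd ij)) (at t))"
  proof
    fix ij assume ij: "ij \<in> I \<times> I"
    show "\<exists>WC. (\<forall>t. \<bar>fst WC t\<bar> \<le> snd WC) \<and>
      (\<forall>t. (fst WC has_real_derivative V (fst ij) t * v (snd ij) t - m (fst ij) (snd ij)) (at t))"
    proof (rule bounded_primitive_product[of "\<omega> (fst (fst ij))" "\<omega> (fst (snd ij))"])
      show "\<omega> (fst (fst ij)) > 0" "\<omega> (fst (snd ij)) > 0"
        using \<omega>I ij by (auto simp: mem_Times_iff)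
      fix W C
      assume W: "\<And>t. \<bar>W t\<bar> \<le> C"
        "\<And>t. (W has_real_derivative (sin (\<omega> (fst (fst ij)) * t + phase \<phi> (fst ij)) / sqrt (\<omega> (fst (fst ij)))) *
           (sqrt (\<omega> (fst (snd ij))) * cos (\<omega> (fst (snd ij)) * t + phase \<phi> (snd ij))) -
           (if \<omega> (fst (fst ij)) = \<omega> (fst (snd ij)) then sin (phase \<phi> (fst ij) - phase \<phi> (snd ij)) / 2 else 0)) (at t)"
      show ?thesis
        unfolding V_def v_def dither_def m_def using W by (intro exI[of _ "(W, C)"]) (simp only: fst_conv snd_conv simp_thms)
    qed
  qed
  from bchoice[OF this] obtain WC where *: "\<forall>ij\<in>I \<times> I. (\<forall>t. \<bar>fst (WC ij) t\<bar> \<le> snd (WC ij)) \<and>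
    (\<forall>t. (fst (WC ij) has_real_derivative V (fst ij) t * v (snd ij) t - m (fst ij) (snd ij)) (at t))"
    by (rule exE)
  have WC: "\<And>ij t. ij \<in> I \<times> I \<Longrightarrow> \<bar>fst (WC ij) t\<bar> \<le> snd (WC ij)"
    "\<And>ij t. ij \<in> I \<times> I \<Longrightarrow>
      (fst (WC ij) has_real_derivative V (fst ij) t * v (snd ij) t - m (fst ij) (snd ij)) (at t)"
    using bspec[OF *] by (simp_all only: simp_thms)
  define A2 where "A2 = (\<Sum>ij\<in>I \<times> I. snd (WC ij))"
  have WC0: "snd (WC ij) \<ge> 0" if "ij \<in> I \<times> I" for ij
    using WC(1)[OF that, of 0] abs_ge_zero order_trans by blast
  have I: "finite I" by (simp add: I_def finite_ctrl_index)
  have A2: "A2 \<ge> 0" "\<And>i j t. i \<in> I \<Longrightarrow> j \<in> I \<Longrightarrow> \<bar>fst (WC (i, j)) t\<bar> \<le> A2"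
  proof -
    show "A2 \<ge> 0" unfolding A2_def using WC0 by (rule sum_nonneg)
    fix i j t assume ij: "i \<in> I" "j \<in> I"
    then have "snd (WC (i, j)) \<le> A2"
      unfolding A2_def using WC0 I by (intro member_le_sum[of "(i, j)" _ "\<lambda>ij. snd (WC ij)"]) auto
    with WC(1)[of "(i, j)" t] ij show "\<bar>fst (WC (i, j)) t\<bar> \<le> A2" by auto
  qed
  obtain CB where CB: "CB > 0" "\<And>i p. i \<in> I \<Longrightarrow> p \<in> K0 \<Longrightarrow> norm (B (fst i) p) \<le> CB"
    using smooth_vf_uniform_bound[OF B D(1)] unfolding I_def by blast
  \<comment> \<open>One constant majorising the dithers, their primitives, the second primitives and
    the control fields.\<close>
  define A where "A = A1 + A2 + M * CB"
  have MCB: "0 \<le> M * CB" using M(1) CB(1) by simp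
  have X: "norm (X i p) \<le> A * (\<sigma> p)\<^sup>2" if "i \<in> I" "p \<in> D" for i p
  proof -
    have "norm (X i p) \<le> M * CB * \<psi> p"
      unfolding X_def using M D(2) D(3)[OF that(2)] CB(2)[OF that(1)] that(2)
      by (intro ctrl_field_bound[where \<delta> = \<delta>]) auto
    also have "\<dots> \<le> A * \<psi> p"
      using A1(1) A2(1) D(3)[OF that(2)]
      by (intro mult_right_mono) (auto simp: A_def)
    finally show ?thesis using \<sigma>(3)[OF that(2)] by simp
  qed
  have lie1: "symb \<sigma> D 1 (lie (B (fst i)) \<psi>)" if "i \<in> I" for i
  proof (rule symb_one[OF smooth_fun_lie[OF BI[OF that] \<psi>] D(1,2)])
    show "0 \<le> C * CB" using grad(1) CB(1) by simp
    fix p assume p: "p \<in> D"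
    show "0 \<le> \<sigma> p" using \<sigma>[OF p] by simp
    have "\<bar>lie (B (fst i)) \<psi> p\<bar> \<le> norm (grad \<psi> p) * norm (B (fst i) p)"
      unfolding lie_eq_inner by (rule Cauchy_Schwarz_ineq2)
    also have "\<dots> \<le> (C * \<sigma> p) * CB"
      using grad(1) grad(2)[OF p] CB(2)[OF that] p D(2) \<sigma>[OF p] by (intro mult_mono) (auto simp: \<sigma>_def)
    finally show "\<bar>lie (B (fst i)) \<psi> p\<bar> \<le> C * CB * \<sigma> p" by (simp add: mult_ac)
  qed
  have lie0: "symb \<sigma> D 0 (lie (B (fst j)) (lie (B (fst i)) \<psi>))" if "i \<in> I" "j \<in> I" for i j
    using symb_smooth[OF smooth_fun_lie[OF BI[OF that(2)] smooth_fun_lie[OF BI[OF that(1)] \<psi>]] D(1,2)]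
      \<sigma> by (simp add: less_imp_le)
  have symh: "symb \<sigma> D 2 (\<lambda>p. h b (\<psi> p))" for b
  proof -
    have "symb \<sigma> D (2 * 1) (\<lambda>p. h b (\<psi> p))"
      by (rule symb_compose[OF \<psi>, where \<delta> = \<delta> and C = C and M = M and g' = "deriv (h b)"])
         (use D(3) grad M admissible_h_DERIV(1)[OF h] in \<open>auto simp: \<sigma>_def\<close>)
    then show ?thesis by simp
  qed
  have symh': "symb \<sigma> D 0 (\<lambda>p. deriv (h b) (\<psi> p))" for b
  proof -
    have "symb \<sigma> D (2 * 0) (\<lambda>p. deriv (h b) (\<psi> p))"
      by (rule symb_compose[OF \<psi>, where \<delta> = \<delta> and C = C and M = M and g' = "deriv (deriv (h b))"])
         (use D(3) grad M admissible_h_DERIV(2)[OF h] in \<open>auto simp: \<sigma>_def\<close>)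
    then show ?thesis by simp
  qed
  have "\<exists>K\<ge>0. \<forall>\<gamma> S. (\<forall>t\<in>S. \<gamma> t \<in> D \<and>
       (\<gamma> has_vector_derivative (\<Sum>i\<in>I. v i t *\<^sub>R X i (\<gamma> t))) (at t within S)) \<longrightarrow>
     (\<exists>z z'. \<forall>t\<in>S. (z has_real_derivative z' t) (at t within S) \<and>
       \<bar>z t - \<psi> (\<gamma> t)\<bar> \<le> K * \<sigma> (\<gamma> t) ^ 3 \<and>
       \<bar>z' t + (\<Sum>i\<in>I. \<Sum>j\<in>I. m i j * G i j (\<gamma> t))\<bar> \<le> K * \<sigma> (\<gamma> t) ^ 5)"
  proof (rule second_order_averaging[where I = I and \<sigma> = \<sigma> and D = D and X = X and A = A and v = v and V = V
        and W = "\<lambda>i j. fst (WC (i, j))" and m = m and \<psi> = \<psi> and \<psi>' = "\<lambda>p w. grad \<psi> p \<bullet> w"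
        and F = F and F' = F' and G = G])
    show "finite I" by (rule I)
    show "0 < \<sigma> p \<and> \<sigma> p \<le> 1" if "p \<in> D" for p by (rule \<sigma>[OF that])
    show "norm (X i p) \<le> A * (\<sigma> p)\<^sup>2" if "i \<in> I" "p \<in> D" for i p by (rule X[OF that])
    show "\<bar>v i t\<bar> \<le> A" if "i \<in> I" for i t
      using A1(2)[OF that, of t] A2(1) MCB by (simp add: A_def)
    show "\<bar>V i t\<bar> \<le> A" if "i \<in> I" for i t
      using A1(3)[OF that, of t] A2(1) MCB by (simp add: A_def)
    show "(V i has_real_derivative v i t) (at t)" if "i \<in> I" for i t
      unfolding V_def[abs_def] v_def by (rule dither_primitive[of \<omega> i \<phi> t, OF \<omega>I[OF that]])
    show "\<bar>fst (WC (i, j)) t\<bar> \<le> A" if "i \<in> I" "j \<in> I" for i j t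
      using A2(2)[OF that, of t] A1(1) MCB by (simp add: A_def)
    show "(fst (WC (i, j)) has_real_derivative V i t * v j t - m i j) (at t)" if "i \<in> I" "j \<in> I" for i j t
      using WC(2)[of "(i, j)" t] that by simp
    show "(\<psi> has_derivative (\<lambda>w. grad \<psi> p \<bullet> w)) (at p)" for p
      by (rule smooth_fun_has_derivative[OF \<psi>])
    show "grad \<psi> p \<bullet> X i p = F i p" for i p
      by (simp add: X_def ctrl_field_def F_def lie_eq_inner)
    show "(F i has_derivative F' i p) (at p)" if "p \<in> D" "i \<in> I" for i p
    proof -
      have "\<psi> p > 0" using D(3)[OF that(1)] by simp
      have "((\<lambda>p. h (snd i) (\<psi> p)) has_derivative (\<lambda>w. deriv (h (snd i)) (\<psi> p) * (grad \<psi> p \<bullet> w))) (at p)"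
        using has_derivative_compose[OF smooth_fun_has_derivative[OF \<psi>]
          admissible_h_DERIV(1)[OF h \<open>\<psi> p > 0\<close>, unfolded has_field_derivative_def]] .
      from has_derivative_mult[OF this smooth_fun_has_derivative[OF smooth_fun_lie[OF BI[OF that(2)] \<psi>]]]
      show ?thesis unfolding F_def[abs_def] F'_def[abs_def] .
    qed
    show "symb \<sigma> D 3 (F i)" if "i \<in> I" for i
      unfolding F_def[abs_def] by (rule symb_mult'[OF symh lie1[OF that]]) (use \<sigma> in auto)
    show "F' i p (X j p) = G i j p" for i j p
      by (simp add: F'_def G_def X_def ctrl_field_def lie_eq_inner algebra_simps)
    \<comment> \<open>Order count: the outer gain contributes 2; inside the bracket the first term
      has order 2 + 0 and the second 0 + 1 + 1.\<close>
    show "symb \<sigma> D 4 (G i j)" if "i \<in> I" "j \<in> I" for i j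
    proof -
      have "symb \<sigma> D 2 (\<lambda>p. h (snd i) (\<psi> p) * lie (B (fst j)) (lie (B (fst i)) \<psi>) p)"
        by (rule symb_mult'[OF symh lie0[OF that]]) (use \<sigma> in auto)
      moreover have "symb \<sigma> D 1 (\<lambda>p. deriv (h (snd i)) (\<psi> p) * lie (B (fst j)) \<psi> p)"
        by (rule symb_mult'[OF symh' lie1[OF that(2)]]) (use \<sigma> in auto)
      then have "symb \<sigma> D 2 (\<lambda>p. (deriv (h (snd i)) (\<psi> p) * lie (B (fst j)) \<psi> p) * lie (B (fst i)) \<psi> p)"
        by (rule symb_mult'[OF _ lie1[OF that(1)]]) (use \<sigma> in auto)
      ultimately have "symb \<sigma> D 2 (\<lambda>p. h (snd i) (\<psi> p) * lie (B (fst j)) (lie (B (fst i)) \<psi>) p +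
          (deriv (h (snd i)) (\<psi> p) * lie (B (fst j)) \<psi> p) * lie (B (fst i)) \<psi> p)"
        by (rule symb_add) (use \<sigma> in auto)
      then show ?thesis
        unfolding G_def[abs_def] by (rule symb_mult'[OF symh]) (use \<sigma> in auto)
    qed
  qed
  then obtain K where K: "K \<ge> 0" "\<forall>\<gamma> S. (\<forall>t\<in>S. \<gamma> t \<in> D \<and>
       (\<gamma> has_vector_derivative (\<Sum>i\<in>I. v i t *\<^sub>R X i (\<gamma> t))) (at t within S)) \<longrightarrow>
     (\<exists>z z'. \<forall>t\<in>S. (z has_real_derivative z' t) (at t within S) \<and>
       \<bar>z t - \<psi> (\<gamma> t)\<bar> \<le> K * \<sigma> (\<gamma> t) ^ 3 \<and>
       \<bar>z' t + (\<Sum>i\<in>I. \<Sum>j\<in>I. m i j * G i j (\<gamma> t))\<bar> \<le> K * \<sigma> (\<gamma> t) ^ 5)"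
    by (elim exE conjE)
  have mean: "c * \<kappa> / 2 * \<sigma> p ^ 4 \<le> (\<Sum>i\<in>I. \<Sum>j\<in>I. m i j * G i j p)" if p: "p \<in> D" for p
  proof -
    have y: "0 < \<psi> p" "\<psi> p < \<delta>" using D(3)[OF p] by auto
    \<comment> \<open>Injectivity of \<open>\<omega>\<close> leaves in the inner sum only the two
      channels belonging to the same input as \<open>i\<close>.\<close>
    have inner: "(\<Sum>j\<in>I. m i j * G i j p) =
        (\<Sum>b\<in>UNIV. sin (phase \<phi> i - phase \<phi> (fst i, b)) / 2 * G i (fst i, b) p)" if "i \<in> I" for i
    proof -
      have i: "fst i \<in> {1..\<mu>}" using that fst_ctrl_index unfolding I_def by blast
      have "(\<Sum>j\<in>I. m i j * G i j p) = (\<Sum>k=1..\<mu>. if k = fst i then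
          (\<Sum>b\<in>UNIV. sin (phase \<phi> i - phase \<phi> (fst i, b)) / 2 * G i (fst i, b) p) else 0)"
        unfolding I_def sum_ctrl_index
        using inj_on_eq_iff[OF \<omega>(2) i]
        by (intro sum.cong) (auto simp: m_def UNIV_bool add.commute)
      then show ?thesis using i by simp
    qed
    \<comment> \<open>The phases of the two channels differ by a quarter period: \<open>m\<close> is
      0 within a channel, 1/2 from cosine to sine and -1/2 from sine to cosine.\<close>
    have "(\<Sum>i\<in>I. \<Sum>j\<in>I. m i j * G i j p) =
        (\<Sum>k=1..\<mu>. (G (k, True) (k, False) p - G (k, False) (k, True) p) / 2)"
      by (simp add: inner) (simp add: I_def sum_ctrl_index UNIV_bool phase_def diff_divide_distrib)
    \<comment> \<open>The iterated Lie derivatives carry the same symmetric factor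
      \<open>h True * h False\<close> in both terms and cancel, so only the Wronskian of the gains
      survives.\<close>
    also have "\<dots> = (\<Sum>k=1..\<mu>. (deriv (h True) (\<psi> p) * h False (\<psi> p) - deriv (h False) (\<psi> p) * h True (\<psi> p)) / 2
        * (lie (B k) \<psi> p)\<^sup>2)"
      by (intro sum.cong) (simp_all add: G_def power2_eq_square field_simps)
    also have "\<dots> \<ge> (\<Sum>k=1..\<mu>. c * \<psi> p / 2 * (lie (B k) \<psi> p)\<^sup>2)"
      using wronskian(2)[OF y] by (intro sum_mono mult_right_mono) auto
    finally have "c * \<psi> p / 2 * (\<Sum>k=1..\<mu>. (lie (B k) \<psi> p)\<^sup>2) \<le> (\<Sum>i\<in>I. \<Sum>j\<in>I. m i j * G i j p)"
      by (simp add: sum_distrib_left)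
    moreover have "c * \<psi> p / 2 * (\<kappa> * \<psi> p) \<le> c * \<psi> p / 2 * (\<Sum>k=1..\<mu>. (lie (B k) \<psi> p)\<^sup>2)"
      using \<kappa>[OF p] wronskian(1) y by (intro mult_left_mono) auto
    moreover have s4: "\<sigma> p ^ 4 = \<psi> p * \<psi> p"
      using \<sigma>(3)[OF p] by (simp add: power4_eq_xxxx power2_eq_square[symmetric] mult.assoc)
    moreover have "c * \<psi> p / 2 * (\<kappa> * \<psi> p) = c * \<kappa> / 2 * (\<psi> p * \<psi> p)" by simp
    ultimately show ?thesis unfolding s4 by linarith
  qed
  show ?thesis
  proof (intro exI[of _ K] conjI allI impI K(1))
    fix \<gamma> S
    assume *: "\<forall>t\<in>S. \<gamma> t \<in> D \<and>
       (\<gamma> has_vector_derivative closed_loop \<mu> B \<psi> \<omega> \<phi> (h True) (h False) t (\<gamma> t)) (at t within S)"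
    then have "\<exists>z z'. \<forall>t\<in>S. (z has_real_derivative z' t) (at t within S) \<and>
       \<bar>z t - \<psi> (\<gamma> t)\<bar> \<le> K * \<sigma> (\<gamma> t) ^ 3 \<and>
       \<bar>z' t + (\<Sum>i\<in>I. \<Sum>j\<in>I. m i j * G i j (\<gamma> t))\<bar> \<le> K * \<sigma> (\<gamma> t) ^ 5"
      unfolding closed_loop_eq_sum I_def[symmetric] v_def[symmetric] X_def[symmetric]
      by (rule K(2)[THEN spec, THEN spec, THEN mp])
    then obtain z z' where z: "\<forall>t\<in>S. (z has_real_derivative z' t) (at t within S) \<and>
       \<bar>z t - \<psi> (\<gamma> t)\<bar> \<le> K * \<sigma> (\<gamma> t) ^ 3 \<and>
       \<bar>z' t + (\<Sum>i\<in>I. \<Sum>j\<in>I. m i j * G i j (\<gamma> t))\<bar> \<le> K * \<sigma> (\<gamma> t) ^ 5"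
      by (elim exE)
    have "z' t \<le> - (c * \<kappa> / 2) * \<sigma> (\<gamma> t) ^ 4 + K * \<sigma> (\<gamma> t) ^ 5" if "t \<in> S" for t
    proof -
      have "\<bar>z' t + (\<Sum>i\<in>I. \<Sum>j\<in>I. m i j * G i j (\<gamma> t))\<bar> \<le> K * \<sigma> (\<gamma> t) ^ 5"
        using z that by blast
      with mean[of "\<gamma> t"] bspec[OF * that] show ?thesis by simp
    qed
    with z show "\<exists>z z'. \<forall>t\<in>S. (z has_real_derivative z' t) (at t within S) \<and>
       \<bar>z t - \<psi> (\<gamma> t)\<bar> \<le> K * sqrt (\<psi> (\<gamma> t)) ^ 3 \<and>
       z' t \<le> - (c * \<kappa> / 2) * sqrt (\<psi> (\<gamma> t)) ^ 4 + K * sqrt (\<psi> (\<gamma> t)) ^ 5"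
      unfolding \<sigma>_def by (intro exI[of _ z] exI[of _ z']) simp
  qed
qed

section \<open>Stability of the minimum\<close>

text \<open>The form is continuous on the compact product of \<open>K\<close> with the unit sphere
  and cannot vanish there, since a vector orthogonal to a spanning set is zero. Its minimum is
  \<open>\<kappa>\<close>, and homogeneity does the rest.\<close>

lemma spanning_lower_bound:
  fixes B :: "nat \<Rightarrow> real^'n::finite \<Rightarrow> real^'n"
  assumes B: "\<forall>k\<in>{1..\<mu>}. smooth_vf (B k)" and K: "compact K" "K \<noteq> {}"
    and span: "\<And>p. p \<in> K \<Longrightarrow> span ((\<lambda>k. B k p) ` {1..\<mu>}) = UNIV"
  obtains \<kappa> where "\<kappa> > 0" "\<And>p v. p \<in> K \<Longrightarrow> \<kappa> * (norm v)\<^sup>2 \<le> (\<Sum>k=1..\<mu>. (v \<bullet> B k p)\<^sup>2)"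
proof -
  define q where "q x = (\<Sum>k=1..\<mu>. (snd x \<bullet> B k (fst x))\<^sup>2)" for x :: "(real^'n) \<times> (real^'n)"
  have "axis undefined 1 \<in> sphere (0::real^'n) 1"
    by simp
  then have ne: "K \<times> sphere (0::real^'n) 1 \<noteq> {}"
    using K(2) by blast
  have "continuous_on (K \<times> sphere 0 1) (\<lambda>x. B k (fst x))" if "k \<in> {1..\<mu>}" for k
    by (rule continuous_on_compose2[OF smooth_vf_continuous_on[of "B k" UNIV] continuous_on_fst[OF continuous_on_id]])
       (use B that in auto)
  then have "continuous_on (K \<times> sphere 0 1) q"
    unfolding q_def[abs_def] by (intro continuous_intros) auto
  then obtain x0 where x0: "x0 \<in> K \<times> sphere 0 1" "\<And>x. x \<in> K \<times> sphere 0 1 \<Longrightarrow> q x0 \<le> q x"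
    using continuous_attains_inf[OF compact_Times[OF K(1) compact_sphere] ne] by blast
  show thesis
  proof
    have q0: "q x0 \<ge> 0" by (auto simp: q_def intro: sum_nonneg)
    have "q x0 \<noteq> 0"
    proof
      assume "q x0 = 0"
      then have *: "snd x0 \<bullet> B k (fst x0) = 0" if "k \<in> {1..\<mu>}" for k
        using that by (simp add: q_def sum_nonneg_eq_0_iff)
      have "snd x0 \<in> span ((\<lambda>k. B k (fst x0)) ` {1..\<mu>})"
        using span[of "fst x0"] x0(1) by auto
      then have "orthogonal (snd x0) (snd x0)"
        by (rule orthogonal_to_span) (use * in \<open>auto simp: orthogonal_def\<close>)
      then show False using x0(1) by (auto simp: orthogonal_self)
    qed
    with q0 show "q x0 > 0" by simp
    fix p v assume p: "p \<in> K"
    show "q x0 * (norm v)\<^sup>2 \<le> (\<Sum>k=1..\<mu>. (v \<bullet> B k p)\<^sup>2)"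
    proof (cases "v = 0")
      case False
      then have "q x0 \<le> q (p, (1 / norm v) *\<^sub>R v)"
        using p by (intro x0(2)) auto
      also have "\<dots> = (\<Sum>k=1..\<mu>. (v \<bullet> B k p)\<^sup>2) / (norm v)\<^sup>2"
        by (simp add: q_def power_divide sum_divide_distrib)
      finally show ?thesis using False by (simp add: field_simps)
    qed simp
  qed
qed

lemma lipschitz_on_linear_combination:
  fixes X :: "'i \<Rightarrow> 'a::metric_space \<Rightarrow> 'b::real_normed_vector"
  assumes "\<forall>i\<in>I. \<exists>L. L-lipschitz_on K (X i)" and v: "\<And>i t. i \<in> I \<Longrightarrow> \<bar>v i t\<bar> \<le> A" and "A \<ge> 0"
  shows "\<exists>L. \<forall>t. L-lipschitz_on K (\<lambda>p. \<Sum>i\<in>I. v i t *\<^sub>R X i p)"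
proof -
  from bchoice[OF assms(1)] obtain L where L: "\<forall>i\<in>I. (L i)-lipschitz_on K (X i)" by (rule exE)
  show ?thesis
  proof (intro exI[of _ "\<Sum>i\<in>I. A * L i"] allI, rule lipschitz_onI)
    fix t x y assume xy: "x \<in> K" "y \<in> K"
    have "dist (\<Sum>i\<in>I. v i t *\<^sub>R X i x) (\<Sum>i\<in>I. v i t *\<^sub>R X i y) = norm (\<Sum>i\<in>I. v i t *\<^sub>R (X i x - X i y))"
      by (simp add: dist_norm sum_subtractf scaleR_diff_right)
    also have "\<dots> \<le> (\<Sum>i\<in>I. A * (L i * dist x y))"
    proof (rule sum_norm_le)
      fix i assume i: "i \<in> I"
      have "norm (X i x - X i y) \<le> L i * dist x y"
        using lipschitz_onD[OF bspec[OF L i] xy] by (simp add: dist_norm)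
      then show "norm (v i t *\<^sub>R (X i x - X i y)) \<le> A * (L i * dist x y)"
        unfolding norm_scaleR using v[OF i, of t] \<open>A \<ge> 0\<close> by (intro mult_mono) auto
    qed
    finally show "dist (\<Sum>i\<in>I. v i t *\<^sub>R X i x) (\<Sum>i\<in>I. v i t *\<^sub>R X i y) \<le> (\<Sum>i\<in>I. A * L i) * dist x y"
      by (simp add: sum_distrib_right mult.assoc)
  next
    show "0 \<le> (\<Sum>i\<in>I. A * L i)"
      using L \<open>A \<ge> 0\<close> lipschitz_on_nonneg by (intro sum_nonneg mult_nonneg_nonneg) blast+
  qed
qed

lemma lipschitz_on_scaleR_bounded:
  fixes f :: "'a::metric_space \<Rightarrow> real" and g :: "'a \<Rightarrow> 'b::real_normed_vector"
  assumes f: "L-lipschitz_on K f" "\<And>x. x \<in> K \<Longrightarrow> \<bar>f x\<bar> \<le> C"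
    and g: "M-lipschitz_on K g" "\<And>x. x \<in> K \<Longrightarrow> norm (g x) \<le> D" and "C \<ge> 0" "D \<ge> 0"
  shows "(L * D + C * M)-lipschitz_on K (\<lambda>x. f x *\<^sub>R g x)"
proof (rule lipschitz_onI)
  have LM: "L \<ge> 0" "M \<ge> 0" using f(1) g(1) by (auto dest: lipschitz_on_nonneg)
  fix x y assume xy: "x \<in> K" "y \<in> K"
  have "f x *\<^sub>R g x - f y *\<^sub>R g y = (f x - f y) *\<^sub>R g x + f y *\<^sub>R (g x - g y)"
    by (simp add: algebra_simps)
  then have "dist (f x *\<^sub>R g x) (f y *\<^sub>R g y) \<le> \<bar>f x - f y\<bar> * norm (g x) + \<bar>f y\<bar> * norm (g x - g y)"
    unfolding dist_norm using norm_triangle_ineq[of "(f x - f y) *\<^sub>R g x" "f y *\<^sub>R (g x - g y)"] by simp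
  also have "\<dots> \<le> (L * dist x y) * D + C * (M * dist x y)"
    using lipschitz_onD[OF f(1) xy] lipschitz_onD[OF g(1) xy] f(2) g(2) xy LM \<open>C \<ge> 0\<close>
    by (intro add_mono mult_mono) (auto simp: dist_norm)
  finally show "dist (f x *\<^sub>R g x) (f y *\<^sub>R g y) \<le> (L * D + C * M) * dist x y"
    by (simp add: algebra_simps)
next
  show "0 \<le> L * D + C * M"
    using f(1) g(1) assms(5,6) by (auto dest!: lipschitz_on_nonneg)
qed

text \<open>First-exit argument. At the first time of distance at least \<open>R\<close>, the whole
  past lies in the closed ball, so \<open>step\<close> applies and puts the solution strictly
  inside, a contradiction.\<close>

lemma trapped_in_ball:
  fixes \<gamma> :: "real \<Rightarrow> 'a::metric_space"
  assumes cont: "continuous_on {t0..} \<gamma>" and start: "dist (\<gamma> t0) p < R"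
    and step: "\<And>T. t0 \<le> T \<Longrightarrow> (\<And>t. t \<in> {t0..T} \<Longrightarrow> dist (\<gamma> t) p \<le> R) \<Longrightarrow> dist (\<gamma> T) p < R"
    and "t0 \<le> t"
  shows "dist (\<gamma> t) p < R"
proof (rule ccontr)
  assume "\<not> dist (\<gamma> t) p < R"
  have contd: "continuous_on {t0..s} (\<lambda>s. dist (\<gamma> s) p)" for s
    by (intro continuous_intros continuous_on_subset[OF cont]) auto
  define S where "S = {s \<in> {t0..t}. R \<le> dist (\<gamma> s) p}"
  have "S \<noteq> {}" using \<open>\<not> dist (\<gamma> t) p < R\<close> \<open>t0 \<le> t\<close> by (auto simp: S_def)
  have "compact S"
  proof -
    have "closed S" unfolding S_def
      by (rule continuous_on_closed_Collect_le[OF continuous_on_const contd]) simp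
    moreover have "S \<subseteq> {t0..t}" by (auto simp: S_def)
    ultimately show ?thesis
      using compact_Int_closed[OF compact_Icc, of S t0 t] by (simp add: Int_absorb1)
  qed
  then obtain T where T: "T \<in> S" "\<And>s. s \<in> S \<Longrightarrow> T \<le> s"
    using compact_attains_inf[OF _ \<open>S \<noteq> {}\<close>] by blast
  then have TT: "t0 \<le> T" "T \<le> t" "R \<le> dist (\<gamma> T) p" by (auto simp: S_def)
  \<comment> \<open>The intermediate value theorem shows that the distance at the first exit is
    exactly \<open>R\<close>, so the endpoint too satisfies the closed bound required by
    \<open>step\<close>.\<close>
  obtain x where x: "t0 \<le> x" "x \<le> T" "dist (\<gamma> x) p = R"
    using IVT'[of "\<lambda>s. dist (\<gamma> s) p" t0 R T] start TT contd[of T] by auto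
  then have "x \<in> S" using TT by (auto simp: S_def)
  with T(2) x have "x = T" by force
  have "dist (\<gamma> s) p \<le> R" if "s \<in> {t0..T}" for s
  proof (cases "s = T")
    case False
    then have "s \<notin> S" using T(2)[of s] that by auto
    then show ?thesis using that TT by (auto simp: S_def)
  qed (use x \<open>x = T\<close> in simp)
  then have "dist (\<gamma> T) p < R" using TT by (intro step) auto
  with TT show False by simp
qed

text \<open>A connected set with points inside and outside a ball meets its boundary sphere, on
  which \<open>f\<close> exceeds \<open>r\<close>. The sublevel set itself may have further pieces
  far from \<open>p\<close>.\<close>

lemma component_subset_ball:
  fixes p :: "'a::euclidean_space" and f :: "'a \<Rightarrow> real"
  assumes "R > 0" "\<And>q. dist q p = R \<Longrightarrow> r < f q"
  shows "connected_component_set {q. f q \<le> r} p \<subseteq> ball p R"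
proof (rule ccontr)
  let ?S = "connected_component_set {q. f q \<le> r} p"
  assume "\<not> ?S \<subseteq> ball p R"
  then have "?S - ball p R \<noteq> {}" by blast
  \<comment> \<open>That \<open>f p \<le> r\<close> is not assumed: a component is empty unless its
    base point lies in the set.\<close>
  moreover from this have "p \<in> ?S"
    using connected_component_eq_empty[of "{q. f q \<le> r}" p] connected_component_refl[of p "{q. f q \<le> r}"] by force
  then have "?S \<inter> ball p R \<noteq> {}"
    using \<open>R > 0\<close> centre_in_ball[of p R] by blast
  ultimately have "?S \<inter> frontier (ball p R) \<noteq> {}"
    by (intro connected_Int_frontier connected_connected_component)
  then obtain q where q: "q \<in> ?S" "q \<in> frontier (ball p R)" by blast
  have "?S \<subseteq> {q. f q \<le> r}"
    by (rule connected_component_subset)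
  then have "f q \<le> r" using q(1) by blast
  moreover have "dist q p = R"
    using q(2) \<open>R > 0\<close> by (simp add: frontier_ball dist_commute)
  ultimately show False
    using assms(2)[of q] by simp
qed

text \<open>For \<open>a = 0\<close> the bound is identically 0; otherwise its denominator grows
  linearly.\<close>

lemma tendsto_of_decay:
  fixes \<gamma> :: "real \<Rightarrow> 'a::metric_space"
  assumes "m > 0" "c > 0" "a \<ge> 0"
    and le: "\<And>t. t \<ge> t0 \<Longrightarrow> m * (dist (\<gamma> t) p)\<^sup>2 \<le> 2 * a / (1 + c * a * (t - t0))"
  shows "(\<gamma> \<longlongrightarrow> p) at_top"
proof -
  have lim: "((\<lambda>t. 2 * a / (1 + c * a * (t - t0)) / m) \<longlongrightarrow> 0) at_top"
  proof (cases "a = 0")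
    case False
    then have "c * a > 0" using assms by simp
    have "filterlim (\<lambda>t. - t0 + t) at_top at_top"
      by (rule filterlim_tendsto_add_at_top[OF tendsto_const filterlim_ident])
    from filterlim_tendsto_pos_mult_at_top[OF tendsto_const \<open>c * a > 0\<close> this]
    have "filterlim (\<lambda>t. 1 + c * a * (- t0 + t)) at_top at_top"
      by (rule filterlim_tendsto_add_at_top[OF tendsto_const])
    then have "filterlim (\<lambda>t. 1 + c * a * (t - t0)) at_top at_top"
      by simp
    then have "((\<lambda>t. 2 * a / (1 + c * a * (t - t0))) \<longlongrightarrow> 0) at_top"
      by (intro real_tendsto_divide_at_top[OF tendsto_const])
    from tendsto_divide_zero[OF this] show ?thesis .
  qed simp
  have "((\<lambda>t. (dist (\<gamma> t) p)\<^sup>2) \<longlongrightarrow> 0) at_top"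
  proof (rule tendsto_sandwich[OF _ _ tendsto_const lim])
    show "\<forall>\<^sub>F t in at_top. (dist (\<gamma> t) p)\<^sup>2 \<le> 2 * a / (1 + c * a * (t - t0)) / m"
      using eventually_ge_at_top[of t0]
    proof eventually_elim
      case (elim t)
      show ?case
        using le[OF elim] by (subst pos_le_divide_eq[OF \<open>m > 0\<close>]) (simp only: mult.commute[of _ m])
    qed
  qed simp
  from tendsto_real_sqrt[OF this] show ?thesis
    by (subst tendsto_dist_iff) simp
qed

text \<open>The interval in the Lipschitz hypothesis on \<open>h\<close> includes 0, so the field is
  Lipschitz across the zero set of \<open>\<psi>\<close>, where it may fail to be
  differentiable.\<close>

lemma ctrl_field_lipschitz:
  fixes B :: "nat \<Rightarrow> real^'n::finite \<Rightarrow> real^'n"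
  assumes B: "\<forall>k\<in>{1..\<mu>}. smooth_vf (B k)" and \<psi>: "smooth_fun \<psi>" and K: "compact K" "convex K"
    and range: "\<And>p. p \<in> K \<Longrightarrow> 0 \<le> \<psi> p \<and> \<psi> p < \<delta>"
    and h: "\<And>b. M-lipschitz_on {0..<\<delta>} (h b)" "\<And>b. h b 0 = 0"
    and i: "i \<in> ctrl_index \<mu>"
  shows "\<exists>L. L-lipschitz_on K (ctrl_field B \<psi> h i)"
proof -
  have Bi: "smooth_vf (B (fst i))" using B fst_ctrl_index[OF i] by blast
  obtain L1 where L1: "L1-lipschitz_on K (B (fst i))" using smooth_vf_lipschitz[OF Bi K] by blast
  obtain L2 where L2: "L2-lipschitz_on K \<psi>" using smooth_fun_lipschitz[OF \<psi> K] by blast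
  obtain C1 where C1: "C1 > 0" "\<And>p. p \<in> K \<Longrightarrow> norm (B (fst i) p) \<le> C1"
    using compact_norm_bound[OF K(1) smooth_vf_continuous_on[OF Bi]] by blast
  have M: "M \<ge> 0" using h(1) by (rule lipschitz_on_nonneg)
  have h\<psi>: "(M * L2)-lipschitz_on K (\<lambda>p. h (snd i) (\<psi> p))"
    using lipschitz_on_compose2[OF L2 lipschitz_on_subset[OF h(1)[of "snd i"]]] range by force
  have bound: "\<bar>h (snd i) (\<psi> p)\<bar> \<le> M * \<delta>" if "p \<in> K" for p
  proof -
    have "\<bar>h (snd i) (\<psi> p)\<bar> \<le> M * \<psi> p"
      using lipschitz_onD[OF h(1)[of "snd i"], of "\<psi> p" 0] range[OF that] h(2)
      by (auto simp: dist_real_def)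
    also have "\<dots> \<le> M * \<delta>" using M range[OF that] by (intro mult_left_mono) auto
    finally show ?thesis .
  qed
  then have "\<bar>h (snd i) (\<psi> p)\<bar> \<le> \<bar>M * \<delta>\<bar>" if "p \<in> K" for p
    using that abs_ge_self order_trans by blast
  then have "(M * L2 * C1 + \<bar>M * \<delta>\<bar> * L1)-lipschitz_on K (\<lambda>p. h (snd i) (\<psi> p) *\<^sub>R B (fst i) p)"
    using C1 by (intro lipschitz_on_scaleR_bounded[OF h\<psi> _ L1]) auto
  then show ?thesis unfolding ctrl_field_def[abs_def] by blast
qed

theorem theorem6p1:
  fixes B :: "nat \<Rightarrow> real^'n \<Rightarrow> real^'n" and \<psi> :: "real^'n \<Rightarrow> real"
    and \<mu> :: nat and \<omega> \<phi> :: "nat \<Rightarrow> real" and h1 h2 :: "real \<Rightarrow> real"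
    and pstar :: "real^'n"
  assumes B_smooth: "\<forall>k\<in>{1..\<mu>}. smooth_vf (B k)"
    and psi_smooth: "smooth_fun \<psi>"
    and psi_nonneg: "\<forall>p. \<psi> p \<ge> 0"
    and psi_zero_nonempty: "{p. \<psi> p = 0} \<noteq> {}"
    and omega_pos: "\<forall>k\<in>{1..\<mu>}. \<omega> k > 0"
    and omega_distinct: "inj_on \<omega> {1..\<mu>}"
    and h1: "admissible_h h1" and h2: "admissible_h h2"
    and h_vi: "\<exists>r' c'. r' > 0 \<and> c' > 0 \<and>
                 (\<forall>y. 0 < y \<and> y \<le> r' \<longrightarrow> deriv h2 y * h1 y - deriv h1 y * h2 y \<le> - c' * y)"
    and pstar_zero: "\<psi> pstar = 0"
    and pstar_strict_min: "\<exists>\<epsilon>>0. \<forall>p. 0 < dist p pstar \<and> dist p pstar < \<epsilon> \<longrightarrow> \<psi> pstar < \<psi> p"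
    and pstar_hessian: "hessian_posdef \<psi> pstar"
    and span_cond: "\<exists>W. open W \<and> pstar \<in> W \<and> (\<forall>p\<in>W. span ((\<lambda>k. B k p) ` {1..\<mu>}) = UNIV)"
  shows "\<exists>c r. c > 0 \<and> r > 0 \<and>
    (\<forall>t0 p0. p0 \<in> connected_component_set {p. \<psi> p \<le> r} pstar \<longrightarrow>
      (\<exists>\<gamma>. \<gamma> t0 = p0 \<and>
           (\<forall>t\<ge>t0. (\<gamma> has_vector_derivative closed_loop \<mu> B \<psi> \<omega> \<phi> h1 h2 t (\<gamma> t)) (at t within {t0..}))) \<and>
      (\<forall>\<gamma>. \<gamma> t0 = p0 \<and>
           (\<forall>t\<ge>t0. (\<gamma> has_vector_derivative closed_loop \<mu> B \<psi> \<omega> \<phi> h1 h2 t (\<gamma> t)) (at t within {t0..}))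
        \<longrightarrow> (\<gamma> \<longlongrightarrow> pstar) at_top \<and>
            (\<forall>t\<ge>t0. \<psi> (\<gamma> t) \<le> 2 * \<psi> p0 / (1 + c * \<psi> p0 * (t - t0)))))"
proof -

  \<comment> \<open>Choice of local constants\<close>
  define h where "h b = (if b then h1 else h2)" for b
  have hT: "h True = h1" "h False = h2" by (simp_all add: h_def)
  have h_adm: "admissible_h (h b)" for b using h1 h2 by (simp add: h_def)
  let ?cl = "closed_loop \<mu> B \<psi> \<omega> \<phi> h1 h2"
  have cl: "?cl t p = (\<Sum>i\<in>ctrl_index \<mu>. dither \<omega> \<phi> i t *\<^sub>R ctrl_field B \<psi> h i p)" for t p
    using closed_loop_eq_sum[where h = h] by (simp add: hT)
  obtain M1 \<delta>1 where M1: "M1 > 0" "\<delta>1 > 0"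
    "\<And>y. 0 \<le> y \<Longrightarrow> y < \<delta>1 \<Longrightarrow> \<bar>h1 y\<bar> \<le> M1 * y"
    "\<And>y. 0 < y \<Longrightarrow> y < \<delta>1 \<Longrightarrow> \<bar>deriv h1 y\<bar> \<le> M1"
    "\<And>y. 0 < y \<Longrightarrow> y < \<delta>1 \<Longrightarrow> \<bar>deriv (deriv h1) y\<bar> * y \<le> M1"
    "M1-lipschitz_on {0..<\<delta>1} h1"
    by (fact admissible_h_local_bounds[OF h1])
  obtain M2 \<delta>2 where M2: "M2 > 0" "\<delta>2 > 0"
    "\<And>y. 0 \<le> y \<Longrightarrow> y < \<delta>2 \<Longrightarrow> \<bar>h2 y\<bar> \<le> M2 * y"
    "\<And>y. 0 < y \<Longrightarrow> y < \<delta>2 \<Longrightarrow> \<bar>deriv h2 y\<bar> \<le> M2"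
    "\<And>y. 0 < y \<Longrightarrow> y < \<delta>2 \<Longrightarrow> \<bar>deriv (deriv h2) y\<bar> * y \<le> M2"
    "M2-lipschitz_on {0..<\<delta>2} h2"
    by (fact admissible_h_local_bounds[OF h2])
  obtain r' c' where rc: "r' > 0" "c' > 0"
    "\<And>y. 0 < y \<Longrightarrow> y \<le> r' \<Longrightarrow> deriv h2 y * h1 y - deriv h1 y * h2 y \<le> - c' * y"
    using h_vi by blast
  define M where "M = max M1 M2"
  \<comment> \<open>Below \<open>\<delta>\<close> both gains obey their bounds and condition (vi)
    applies; the 1 keeps the weight \<open>sqrt \<psi>\<close> at most 1.\<close>
  define \<delta> where "\<delta> = min (min \<delta>1 \<delta>2) (min r' 1)"
  have M: "M > 0" "M1 \<le> M" "M2 \<le> M" using M1(1) by (auto simp: M_def)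
  have \<delta>: "\<delta> > 0" "\<delta> \<le> \<delta>1" "\<delta> \<le> \<delta>2" "\<delta> \<le> r'" "\<delta> \<le> 1"
    using M1(2) M2(2) rc(1) by (auto simp: \<delta>_def)
  have hb1: "\<bar>h b y\<bar> \<le> M * y" if "0 \<le> y" "y < \<delta>" for b y
    using M1(3)[of y] M2(3)[of y] that \<delta> mult_right_mono[OF M(2), of y] mult_right_mono[OF M(3), of y]
    by (auto simp: h_def)
  have hb2: "\<bar>deriv (h b) y\<bar> \<le> M" if "0 < y" "y < \<delta>" for b y
    using M1(4)[of y] M2(4)[of y] that \<delta> M by (auto simp: h_def)
  have hb3: "\<bar>deriv (deriv (h b)) y\<bar> * y \<le> M" if "0 < y" "y < \<delta>" for b y
    using M1(5)[of y] M2(5)[of y] that \<delta> M by (auto simp: h_def)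
  have hb4: "M-lipschitz_on {0..<\<delta>} (h b)" for b
    using lipschitz_on_mono[OF M1(6), of "{0..<\<delta>}" M] lipschitz_on_mono[OF M2(6), of "{0..<\<delta>}" M] M \<delta>
    by (auto simp: h_def)
  have wronskian: "deriv (h False) y * h True y - deriv (h True) y * h False y \<le> - c' * y"
    if "0 < y" "y < \<delta>" for y
    using rc(3)[of y] that \<delta> by (simp add: hT)
  obtain R0 m C where R0: "R0 > 0" "m > 0" "C > 0"
    "\<And>p. p \<in> cball pstar R0 \<Longrightarrow> m * (dist p pstar)\<^sup>2 \<le> \<psi> p"
    "\<And>p. p \<in> cball pstar R0 \<Longrightarrow> \<psi> p \<le> C * (dist p pstar)\<^sup>2"
    "\<And>p. p \<in> cball pstar R0 \<Longrightarrow> norm (grad \<psi> p) \<le> C * dist p pstar"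
    "\<And>p. p \<in> cball pstar R0 \<Longrightarrow> m * (dist p pstar)\<^sup>2 \<le> grad \<psi> p \<bullet> (p - pstar)"
    by (fact nondegenerate_minimum_bounds[OF psi_smooth psi_nonneg[rule_format] pstar_zero pstar_hessian])
  obtain W where W: "open W" "pstar \<in> W" "\<And>p. p \<in> W \<Longrightarrow> span ((\<lambda>k. B k p) ` {1..\<mu>}) = UNIV"
    using span_cond by blast
  obtain RW where RW: "RW > 0" "cball pstar RW \<subseteq> W"
    using open_contains_cball_eq[OF W(1)] W(2) by blast
  \<comment> \<open>The last entry makes \<open>C * (dist p pstar)\<^sup>2\<close> at most
    \<open>\<delta> / 2\<close>, so that \<open>\<psi>\<close> stays below \<open>\<delta>\<close>
    on the closed ball.\<close>
  define R1 where "R1 = min (min R0 RW) (sqrt (\<delta> / (2 * C)))"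
  have R1: "R1 > 0" "R1 \<le> R0" "R1 \<le> RW" "R1 \<le> sqrt (\<delta> / (2 * C))"
    using R0 RW \<delta> by (auto simp: R1_def)
  have in_R0: "p \<in> cball pstar R0" if "dist p pstar \<le> R1" for p
    using that R1 by (simp add: dist_commute)
  have \<psi>small: "\<psi> p < \<delta>" if "dist p pstar \<le> R1" for p
  proof -
    have "(dist p pstar)\<^sup>2 \<le> (sqrt (\<delta> / (2 * C)))\<^sup>2"
      using that R1 by (intro power_mono) auto
    also have "\<dots> = \<delta> / (2 * C)" using \<delta> R0 by simp
    finally have "C * (dist p pstar)\<^sup>2 \<le> C * (\<delta> / (2 * C))"
      using R0 by (intro mult_left_mono) auto
    also have "\<dots> < \<delta>" using \<delta>(1) R0(3) by simp
    finally show ?thesis using R0(5)[OF in_R0[OF that]] by linarith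
  qed
  have dist_le: "dist p pstar \<le> sqrt (\<psi> p) / sqrt m" if "dist p pstar \<le> R1" for p
  proof -
    have "sqrt (m * (dist p pstar)\<^sup>2) \<le> sqrt (\<psi> p)"
      using R0(4)[OF in_R0[OF that]] by simp
    then show ?thesis using R0(2) by (simp add: real_sqrt_mult pos_le_divide_eq mult.commute)
  qed
  define Cg where "Cg = C / sqrt m"
  have Cg: "Cg \<ge> 0" using R0 by (simp add: Cg_def)
  have grad_le: "norm (grad \<psi> p) \<le> Cg * sqrt (\<psi> p)" if "dist p pstar \<le> R1" for p
  proof -
    have "norm (grad \<psi> p) \<le> C * dist p pstar" by (rule R0(6)[OF in_R0[OF that]])
    also have "\<dots> \<le> C * (sqrt (\<psi> p) / sqrt m)"
      using dist_le[OF that] R0 by (intro mult_left_mono) auto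
    finally show ?thesis by (simp add: Cg_def)
  qed
  have "cball pstar R1 \<noteq> {}" using R1(1) by auto
  moreover have "span ((\<lambda>k. B k p) ` {1..\<mu>}) = UNIV" if "p \<in> cball pstar R1" for p
    using that RW(2) R1(3) by (intro W(3)) auto
  ultimately obtain \<kappa>0 where \<kappa>0: "\<kappa>0 > 0"
    "\<And>p v. p \<in> cball pstar R1 \<Longrightarrow> \<kappa>0 * (norm v)\<^sup>2 \<le> (\<Sum>k=1..\<mu>. (v \<bullet> B k p)\<^sup>2)"
    using spanning_lower_bound[OF B_smooth compact_cball] by metis
  \<comment> \<open>\<open>\<kappa>0\<close> comes from the spanning condition; the squared gradient
    is at least \<open>m\<^sup>2\<close> times the squared distance, which in turn is at least
    \<open>\<psi> / C\<close>.\<close>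
  define \<kappa> where "\<kappa> = \<kappa>0 * (m\<^sup>2 / C)"
  have \<kappa>: "\<kappa> > 0" using \<kappa>0 R0 by (simp add: \<kappa>_def)
  have lie_lower: "\<kappa> * \<psi> p \<le> (\<Sum>k=1..\<mu>. (lie (B k) \<psi> p)\<^sup>2)" if p: "dist p pstar \<le> R1" for p
  proof -
    have "m * dist p pstar \<le> norm (grad \<psi> p)"
    proof (cases "p = pstar")
      case False
      have "dist p pstar * (m * dist p pstar) \<le> grad \<psi> p \<bullet> (p - pstar)"
        using R0(7)[OF in_R0[OF p]] by (simp add: power2_eq_square mult_ac)
      also have "\<dots> \<le> norm (grad \<psi> p) * norm (p - pstar)" by (rule norm_cauchy_schwarz)
      also have "\<dots> = dist p pstar * norm (grad \<psi> p)" by (simp add: dist_norm)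
      finally show ?thesis using False by simp
    qed simp
    then have "(m * dist p pstar)\<^sup>2 \<le> (norm (grad \<psi> p))\<^sup>2"
      using R0 by (intro power_mono) auto
    then have "m\<^sup>2 * (dist p pstar)\<^sup>2 \<le> (norm (grad \<psi> p))\<^sup>2"
      by (simp add: power_mult_distrib)
    moreover have "m\<^sup>2 / C * \<psi> p \<le> m\<^sup>2 / C * (C * (dist p pstar)\<^sup>2)"
      using R0(5)[OF in_R0[OF p]] R0(2,3) by (intro mult_left_mono) auto
    ultimately have "m\<^sup>2 / C * \<psi> p \<le> (norm (grad \<psi> p))\<^sup>2"
      using R0(3) by simp
    then have "\<kappa> * \<psi> p \<le> \<kappa>0 * (norm (grad \<psi> p))\<^sup>2"
      using mult_left_mono[of "m\<^sup>2 / C * \<psi> p" "(norm (grad \<psi> p))\<^sup>2" \<kappa>0] \<kappa>0(1) by (simp add: \<kappa>_def mult.assoc)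
    also have "\<dots> \<le> (\<Sum>k=1..\<mu>. (grad \<psi> p \<bullet> B k p)\<^sup>2)"
      using p by (intro \<kappa>0(2)) (simp add: dist_commute)
    finally show ?thesis by (simp add: lie_eq_inner)
  qed
  \<comment> \<open>By the quadratic lower bound on \<open>\<psi>\<close> this is the ball without
    its centre.\<close>
  define D where "D = {p \<in> cball pstar R1. 0 < \<psi> p}"
  have D: "dist p pstar \<le> R1" "0 < \<psi> p" if "p \<in> D" for p
    using that by (simp_all add: D_def dist_commute)
  have "\<exists>K\<ge>0. \<forall>\<gamma> S. (\<forall>t\<in>S. \<gamma> t \<in> D \<and>
       (\<gamma> has_vector_derivative closed_loop \<mu> B \<psi> \<omega> \<phi> (h True) (h False) t (\<gamma> t)) (at t within S)) \<longrightarrow>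
     (\<exists>z z'. \<forall>t\<in>S. (z has_real_derivative z' t) (at t within S) \<and>
       \<bar>z t - \<psi> (\<gamma> t)\<bar> \<le> K * sqrt (\<psi> (\<gamma> t)) ^ 3 \<and>
       z' t \<le> - (c' * \<kappa> / 2) * sqrt (\<psi> (\<gamma> t)) ^ 4 + K * sqrt (\<psi> (\<gamma> t)) ^ 5)"
  proof (rule closed_loop_averaging[OF B_smooth psi_smooth omega_pos omega_distinct h_adm M(1) hb1 hb2 hb3 rc(2) wronskian,
        where ?K0.0 = "cball pstar R1" and C = Cg])
    show "D \<subseteq> cball pstar R1" by (auto simp: D_def)
    show "0 < \<psi> p \<and> \<psi> p < \<delta> \<and> \<psi> p \<le> 1" if "p \<in> D" for p
      using D[OF that] \<psi>small[of p] \<delta> by auto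
  qed (use Cg grad_le lie_lower D in auto)
  then obtain K where K: "K \<ge> 0" "\<forall>\<gamma> S. (\<forall>t\<in>S. \<gamma> t \<in> D \<and>
       (\<gamma> has_vector_derivative ?cl t (\<gamma> t)) (at t within S)) \<longrightarrow>
     (\<exists>z z'. \<forall>t\<in>S. (z has_real_derivative z' t) (at t within S) \<and>
       \<bar>z t - \<psi> (\<gamma> t)\<bar> \<le> K * sqrt (\<psi> (\<gamma> t)) ^ 3 \<and>
       z' t \<le> - (c' * \<kappa> / 2) * sqrt (\<psi> (\<gamma> t)) ^ 4 + K * sqrt (\<psi> (\<gamma> t)) ^ 5)"
    unfolding hT by (elim exE conjE)
  define c0 where "c0 = c' * \<kappa> / 2"
  have c0: "c0 > 0" using rc(2) \<kappa> by (simp add: c0_def)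
  \<comment> \<open>The threshold for \<open>sqrt \<psi>\<close> that meets both smallness
    conditions of \<open>perturbed_riccati_decay\<close>. Dividing by \<open>K + 1\<close> covers
    \<open>K = 0\<close>.\<close>
  define s0 where "s0 = min (1 / 5) (c0 / 2) / (K + 1)"
  have s0: "s0 > 0" "K * s0 \<le> 1 / 5" "K * s0 \<le> c0 / 2"
  proof -
    show "s0 > 0" using c0 K(1) by (simp add: s0_def)
    have "K * s0 \<le> (K + 1) * s0" using \<open>s0 > 0\<close> by (intro mult_right_mono) auto
    also have "\<dots> = min (1 / 5) (c0 / 2)" using K(1) by (simp add: s0_def)
    finally show "K * s0 \<le> 1 / 5" "K * s0 \<le> c0 / 2" by simp_all
  qed
  \<comment> \<open>On this smaller ball \<open>sqrt \<psi>\<close> is at most \<open>sqrt C\<close>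
    times the distance, hence at most \<open>s0\<close>.\<close>
  define R where "R = min R1 (s0 / sqrt C)"
  have R: "R > 0" "R \<le> R1" "R \<le> s0 / sqrt C" using R1(1) s0(1) R0(3) by (auto simp: R_def)
  have \<sigma>small: "sqrt (\<psi> p) \<le> s0" if "dist p pstar \<le> R" for p
  proof -
    have "dist p pstar \<le> R1" using that R by simp
    then have "sqrt (\<psi> p) \<le> sqrt (C * (dist p pstar)\<^sup>2)"
      using R0(5)[OF in_R0] by simp
    also have "\<dots> = sqrt C * dist p pstar" by (simp add: real_sqrt_mult)
    also have "\<dots> \<le> sqrt C * (s0 / sqrt C)"
      using that R R0(3) by (intro mult_left_mono) auto
    finally show ?thesis using R0(3) by simp
  qed
  obtain CB where CB: "CB > 0" "\<And>i p. i \<in> ctrl_index \<mu> \<Longrightarrow> p \<in> cball pstar R1 \<Longrightarrow> norm (B (fst i) p) \<le> CB"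
    by (fact smooth_vf_uniform_bound[OF B_smooth compact_cball])
  obtain A where A: "A \<ge> 0" "\<And>i t. i \<in> ctrl_index \<mu> \<Longrightarrow> \<bar>dither \<omega> \<phi> i t\<bar> \<le> A"
    "\<And>i t. i \<in> ctrl_index \<mu> \<Longrightarrow> \<bar>sin (\<omega> (fst i) * t + phase \<phi> i) / sqrt (\<omega> (fst i))\<bar> \<le> A"
    by (fact dither_bounds[OF omega_pos])
  define Cv where "Cv = real (card (ctrl_index \<mu>)) * (A * (M * CB))"
  have Cv: "Cv \<ge> 0" using A M CB by (simp add: Cv_def)
  have cl_bound: "norm (?cl t p) \<le> Cv * \<psi> p" if p: "dist p pstar \<le> R1" for t p
  proof -
    have "norm (?cl t p) \<le> (\<Sum>i\<in>ctrl_index \<mu>. A * (M * CB * \<psi> p))"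
      unfolding cl
    proof (rule sum_norm_le)
      fix i assume i: "i \<in> ctrl_index \<mu>"
      have "norm (ctrl_field B \<psi> h i p) \<le> M * CB * \<psi> p"
        using psi_nonneg \<psi>small[OF p] CB(2)[OF i, of p] p M(1)
        by (intro ctrl_field_bound[where \<delta> = \<delta>] hb1) (auto simp: dist_commute)
      then show "norm (dither \<omega> \<phi> i t *\<^sub>R ctrl_field B \<psi> h i p) \<le> A * (M * CB * \<psi> p)"
        unfolding norm_scaleR using A(1) A(2)[OF i, of t] by (intro mult_mono) auto
    qed
    then show ?thesis by (simp add: Cv_def mult_ac)
  qed
  \<comment> \<open>A crude relative rate of change of \<open>\<psi>\<close>, just enough to prevent
    \<open>\<psi>\<close> from reaching or leaving zero in finite time.\<close>
  define CE where "CE = Cg * Cv"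
  have \<psi>'_bound: "\<bar>grad \<psi> p \<bullet> ?cl t p\<bar> \<le> CE * \<psi> p" if p: "dist p pstar \<le> R1" for t p
  proof -
    have \<psi>1: "sqrt (\<psi> p) \<le> 1" "0 \<le> \<psi> p" using \<psi>small[OF p] \<delta>(5) psi_nonneg by auto
    have "\<bar>grad \<psi> p \<bullet> ?cl t p\<bar> \<le> norm (grad \<psi> p) * norm (?cl t p)"
      by (rule Cauchy_Schwarz_ineq2)
    also have "\<dots> \<le> (Cg * 1) * (Cv * \<psi> p)"
      using order_trans[OF grad_le[OF p] mult_left_mono[OF \<psi>1(1) Cg]] cl_bound[OF p] Cg
      by (intro mult_mono) auto
    finally show ?thesis by (simp add: CE_def)
  qed
  \<comment> \<open>Leaves room for the overshoot: \<open>\<psi>\<close> may double to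
    \<open>m * R\<^sup>2 / 2\<close>, still below the value \<open>m * R\<^sup>2\<close> that it has
    at least on the sphere of radius \<open>R\<close>.\<close>
  define r where "r = m * R\<^sup>2 / 4"
  have r: "r > 0" using R R0 by (simp add: r_def)
  have start: "dist p0 pstar < R \<and> \<psi> p0 \<le> r"
    if "p0 \<in> connected_component_set {p. \<psi> p \<le> r} pstar" for p0
  proof -
    have "connected_component_set {p. \<psi> p \<le> r} pstar \<subseteq> ball pstar R"
    proof (rule component_subset_ball[OF R(1)])
      fix q assume q: "dist q pstar = R"
      have "r < m * R\<^sup>2" using R R0 by (simp add: r_def)
      also have "\<dots> \<le> \<psi> q" using R0(4)[OF in_R0, of q] q R by simp
      finally show "r < \<psi> q" .
    qed
    then show ?thesis
      using that connected_component_subset[of "{p. \<psi> p \<le> r}" pstar] by (auto simp: dist_commute)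
  qed

  \<comment> \<open>Decay while in the ball, and confinement to it\<close>
  have decay: "\<psi> (\<gamma> T) \<le> 2 * \<psi> (\<gamma> t0) / (1 + c0 / 4 * \<psi> (\<gamma> t0) * (T - t0))"
    if "t0 \<le> T" and \<gamma>R: "\<And>t. t \<in> {t0..T} \<Longrightarrow> dist (\<gamma> t) pstar \<le> R"
      and \<gamma>': "\<And>t. t \<in> {t0..T} \<Longrightarrow> (\<gamma> has_vector_derivative ?cl t (\<gamma> t)) (at t within {t0..T})" for \<gamma> t0 T
  proof -
    have \<gamma>R1: "dist (\<gamma> t) pstar \<le> R1" if "t \<in> {t0..T}" for t
      using \<gamma>R[OF that] R by simp
    have y': "((\<lambda>t. \<psi> (\<gamma> t)) has_real_derivative grad \<psi> (\<gamma> t) \<bullet> ?cl t (\<gamma> t)) (at t within {t0..s})"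
      if "t \<in> {t0..s}" "s \<le> T" for t s
      by (rule DERIV_along_curve[OF smooth_fun_has_derivative[OF psi_smooth]
            has_vector_derivative_within_subset[OF \<gamma>']]) (use that in auto)
    have exp: "\<psi> (\<gamma> t0) * exp (- CE * (s - t0)) \<le> \<psi> (\<gamma> s)" "\<psi> (\<gamma> s) \<le> \<psi> (\<gamma> t0) * exp (CE * (s - t0))"
      if "s \<in> {t0..T}" for s
      using exponential_bounds[of t0 s "\<lambda>t. \<psi> (\<gamma> t)" "\<lambda>t. grad \<psi> (\<gamma> t) \<bullet> ?cl t (\<gamma> t)" CE]
        y' \<psi>'_bound[OF \<gamma>R1] that by auto
    show ?thesis
    \<comment> \<open>The averaging estimate needs \<open>\<psi>\<close> positive along the curve. A
      solution starting at a zero has both sides of the claim equal to 0.\<close>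
    proof (cases "\<psi> (\<gamma> t0) = 0")
      case True
      then show ?thesis using exp(2)[of T] \<open>t0 \<le> T\<close> by simp
    next
      case False
      then have pos0: "\<psi> (\<gamma> t0) > 0" using psi_nonneg by (simp add: less_le)
      have pos: "\<psi> (\<gamma> t) > 0" if "t \<in> {t0..T}" for t
        using exp(1)[OF that] pos0 by (smt (verit) exp_gt_zero mult_pos_pos)
      then have "\<forall>t\<in>{t0..T}. \<gamma> t \<in> D \<and> (\<gamma> has_vector_derivative ?cl t (\<gamma> t)) (at t within {t0..T})"
        using \<gamma>R1 \<gamma>' by (auto simp: D_def dist_commute)
      then have "\<exists>z z'. \<forall>t\<in>{t0..T}. (z has_real_derivative z' t) (at t within {t0..T}) \<and>
         \<bar>z t - \<psi> (\<gamma> t)\<bar> \<le> K * sqrt (\<psi> (\<gamma> t)) ^ 3 \<and>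
         z' t \<le> - c0 * sqrt (\<psi> (\<gamma> t)) ^ 4 + K * sqrt (\<psi> (\<gamma> t)) ^ 5"
        unfolding c0_def by (rule K(2)[THEN spec, THEN spec, THEN mp])
      then obtain z z' where z: "\<forall>t\<in>{t0..T}. (z has_real_derivative z' t) (at t within {t0..T}) \<and>
         \<bar>z t - \<psi> (\<gamma> t)\<bar> \<le> K * sqrt (\<psi> (\<gamma> t)) ^ 3 \<and>
         z' t \<le> - c0 * sqrt (\<psi> (\<gamma> t)) ^ 4 + K * sqrt (\<psi> (\<gamma> t)) ^ 5"
        by (elim exE)
      show ?thesis
      proof (rule perturbed_riccati_decay[OF \<open>t0 \<le> T\<close>, where K = K and z = z and z' = z'])
        fix t assume t: "t \<in> {t0..T}"
        note * = bspec[OF z t]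
        show "0 < \<psi> (\<gamma> t)" by (rule pos[OF t])
        show "(z has_real_derivative z' t) (at t within {t0..T})" using * by blast
        show "\<bar>z t - \<psi> (\<gamma> t)\<bar> \<le> K * sqrt (\<psi> (\<gamma> t)) ^ 3" using * by blast
        show "z' t \<le> - c0 * sqrt (\<psi> (\<gamma> t)) ^ 4 + K * sqrt (\<psi> (\<gamma> t)) ^ 5" using * by blast
        show "K * sqrt (\<psi> (\<gamma> t)) \<le> 1 / 5" "K * sqrt (\<psi> (\<gamma> t)) \<le> c0 / 2"
          using mult_left_mono[OF \<sigma>small[OF \<gamma>R[OF t]] K(1)] s0 by linarith+
      qed (rule c0)
    qed
  qed
  \<comment> \<open>The equation is assumed only while the curve is in the closed ball, so the
    statement covers solutions of the projected equation as well as those of the closed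
    loop.\<close>
  have trap: "dist (\<gamma> t) pstar < R"
    if \<gamma>0: "dist (\<gamma> t0) pstar < R" "\<psi> (\<gamma> t0) \<le> r" and cont: "continuous_on {t0..} \<gamma>"
      and \<gamma>': "\<And>t. t0 \<le> t \<Longrightarrow> dist (\<gamma> t) pstar \<le> R \<Longrightarrow>
         (\<gamma> has_vector_derivative ?cl t (\<gamma> t)) (at t within {t0..})"
      and "t0 \<le> t" for \<gamma> t0 t
  proof (rule trapped_in_ball[OF cont \<gamma>0(1) _ \<open>t0 \<le> t\<close>])
    fix T assume T: "t0 \<le> T" "\<And>t. t \<in> {t0..T} \<Longrightarrow> dist (\<gamma> t) pstar \<le> R"
    have d: "1 \<le> 1 + c0 / 4 * \<psi> (\<gamma> t0) * (T - t0)"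
      using c0 psi_nonneg T(1) by simp
    have "m * (dist (\<gamma> T) pstar)\<^sup>2 \<le> \<psi> (\<gamma> T)"
      using R0(4)[OF in_R0] T R by force
    also have "\<dots> \<le> 2 * \<psi> (\<gamma> t0) / (1 + c0 / 4 * \<psi> (\<gamma> t0) * (T - t0))"
      by (intro decay T has_vector_derivative_within_subset[OF \<gamma>']) (use T in auto)
    also have "\<dots> \<le> 2 * \<psi> (\<gamma> t0) / 1"
      using d psi_nonneg by (intro divide_left_mono) auto
    also have "\<dots> \<le> 2 * r" using \<gamma>0 by simp
    also have "\<dots> < m * R\<^sup>2" using R R0 by (simp add: r_def)
    finally have "(dist (\<gamma> T) pstar)\<^sup>2 < R\<^sup>2" using R0(2) by simp
    then show "dist (\<gamma> T) pstar < R" by (rule power_less_imp_less_base) (use R in simp)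
  qed

  \<comment> \<open>Global existence, and the estimate for every solution\<close>
  have "\<forall>i\<in>ctrl_index \<mu>. \<exists>L. L-lipschitz_on (cball pstar R) (ctrl_field B \<psi> h i)"
    using psi_nonneg \<psi>small R admissible_h_zero[OF h_adm]
    by (intro ballI ctrl_field_lipschitz[OF B_smooth psi_smooth, where \<delta> = \<delta> and M = M] hb4)
       (auto simp: dist_commute)
  then have "\<exists>L. \<forall>t. L-lipschitz_on (cball pstar R) (\<lambda>p. \<Sum>i\<in>ctrl_index \<mu>. dither \<omega> \<phi> i t *\<^sub>R ctrl_field B \<psi> h i p)"
    by (rule lipschitz_on_linear_combination[where A = A]) (use A in auto)
  then obtain L where L: "\<forall>t. L-lipschitz_on (cball pstar R) (?cl t)"
    unfolding cl[abs_def] by (rule exE)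
  have ne: "cball pstar R \<noteq> {}" using R(1) by auto
  \<comment> \<open>Composing with the projection onto the ball makes the field globally Lipschitz; solutions never leave
    the ball, so the modification is invisible.\<close>
  let ?P = "closest_point (cball pstar R)"
  have P: "?P x \<in> cball pstar R" for x
    using closest_point_in_set[OF closed_cball ne] .
  have P1: "1-lipschitz_on UNIV ?P"
    using closest_point_lipschitz[OF convex_cball closed_cball ne] by (intro lipschitz_onI) auto
  have existence: "\<exists>\<gamma>. \<gamma> t0 = p0 \<and> (\<forall>t\<ge>t0. (\<gamma> has_vector_derivative ?cl t (\<gamma> t)) (at t within {t0..}))"
    if p0: "dist p0 pstar < R" "\<psi> p0 \<le> r" for t0 p0
  proof -
    have "\<exists>\<gamma>. \<gamma> t0 = p0 \<and> (\<forall>t\<ge>t0. (\<gamma> has_vector_derivative ?cl t (?P (\<gamma> t))) (at t within {t0..}))"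
    proof (rule global_ode_solution[where F = "\<lambda>t x. ?cl t (?P x)" and L = "L * 1" and M = "Cv * \<delta>"])
      show "(L * 1)-lipschitz_on UNIV (\<lambda>x. ?cl t (?P x))" for t
        using P by (intro lipschitz_on_compose2[OF P1 lipschitz_on_subset[OF L[THEN spec]]]) auto
      show "continuous_on UNIV (\<lambda>t. ?cl t (?P x))" for x
        unfolding closed_loop_def by (intro continuous_intros)
      show "norm (?cl t (?P x)) \<le> Cv * \<delta>" for t x
      proof -
        have "dist (?P x) pstar \<le> R1" using P[of x] R by (simp add: dist_commute)
        from cl_bound[OF this] \<psi>small[OF this] Cv show ?thesis
          by (meson less_imp_le mult_left_mono order_trans)
      qed
    qed
    then obtain \<gamma> where \<gamma>: "\<gamma> t0 = p0"
      "\<And>t. t \<ge> t0 \<Longrightarrow> (\<gamma> has_vector_derivative ?cl t (?P (\<gamma> t))) (at t within {t0..})"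
      by blast
    \<comment> \<open>On the ball the projection is the identity, so the projected equation agrees
      with the closed loop there, as \<open>trap\<close> demands.\<close>
    have self: "?P x = x" if "dist x pstar \<le> R" for x
      using that by (intro closest_point_self) (simp add: dist_commute)
    have "continuous_on {t0..} \<gamma>"
      using has_vector_derivative_continuous[OF \<gamma>(2)] by (simp add: continuous_on_eq_continuous_within)
    then have "dist (\<gamma> t) pstar < R" if "t0 \<le> t" for t
      using \<gamma> p0 self that by (intro trap) force+
    then have "(\<gamma> has_vector_derivative ?cl t (\<gamma> t)) (at t within {t0..})" if "t0 \<le> t" for t
      using \<gamma>(2)[OF that] self[of "\<gamma> t"] that by (simp add: less_imp_le)
    with \<gamma>(1) show ?thesis by blast
  qed
  have estimate: "(\<gamma> \<longlongrightarrow> pstar) at_top \<and> (\<forall>t\<ge>t0. \<psi> (\<gamma> t) \<le> 2 * \<psi> p0 / (1 + c0 / 4 * \<psi> p0 * (t - t0)))"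
    if p0: "dist p0 pstar < R" "\<psi> p0 \<le> r" and \<gamma>0: "\<gamma> t0 = p0"
      and \<gamma>': "\<And>t. t0 \<le> t \<Longrightarrow> (\<gamma> has_vector_derivative ?cl t (\<gamma> t)) (at t within {t0..})" for t0 p0 \<gamma>
  proof -
    have "continuous_on {t0..} \<gamma>"
      using has_vector_derivative_continuous[OF \<gamma>'] by (simp add: continuous_on_eq_continuous_within)
    then have inR: "dist (\<gamma> t) pstar < R" if "t0 \<le> t" for t
      using \<gamma>0 \<gamma>' p0 that by (intro trap) auto
    have est: "\<psi> (\<gamma> t) \<le> 2 * \<psi> p0 / (1 + c0 / 4 * \<psi> p0 * (t - t0))" if "t0 \<le> t" for t
      using decay[OF that, of \<gamma>] inR has_vector_derivative_within_subset[OF \<gamma>'] \<gamma>0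
      by (force simp: less_imp_le)
    have "(\<gamma> \<longlongrightarrow> pstar) at_top"
    proof (rule tendsto_of_decay[OF R0(2), where c = "c0 / 4" and a = "\<psi> p0"])
      \<comment> \<open>Convergence of the state follows from the decay of \<open>\<psi>\<close>
        because confinement keeps the quadratic lower bound valid for all later times.\<close>
      show "m * (dist (\<gamma> t) pstar)\<^sup>2 \<le> 2 * \<psi> p0 / (1 + c0 / 4 * \<psi> p0 * (t - t0))" if "t0 \<le> t" for t
        using R0(4)[OF in_R0, of "\<gamma> t"] inR[OF that] R est[OF that] by linarith
    qed (use c0 psi_nonneg in auto)
    with est show ?thesis by blast
  qed
  show ?thesis
    using c0 r start existence estimate
    by (intro exI[of _ "c0 / 4"] exI[of _ r] conjI allI impI) (simp, simp, blast, blast, blast)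
qed

end
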